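(* Let $M$ be a two-point-homogeneous $G$-space as described in the context, let $s\ge1$, and let $A(M,s)$ be the maximum cardinality of a finite set $X\subset M$ with $|D(X)|=s$. For $D\in\mathfrak{D}(M,s)$ let $B(D):=\min\{H(D),L(D)\}$. Then \[ A(M,s)\le \max\Big\{\max_{D\in\mathfrak{D}(M,s)} B(D),\; 2N(M,s)-1\Big\}. \]
   Context: $G$ is a finite group or a connected compact group acting on a metric space $M$ with distance function $\tau$, which is strongly invariant: for $x,y,x',y'\in M$, $\tau(x,y)=\tau(x',y')$ iff there is $g\in G$ with $g(x)=x'$, $g(y)=y'$. If $G$ is infinite, $M$ is a connected Riemannian manifold and $\tau$ is a constant times the natural distance; if $G$ is finite, with $d_0=\min_{x\ne y}\tau(x,y)$, $M$ is a graph in which $x\sim y$ iff $\tau(x,y)=d_0$, and $\tau$ is a constant times the graph distance. Let $\mu$ be the normalized $G$-invariant measure on $M$. The space $L^2(M)$ decomposes as an orthogonal direct sum of subspaces $V_0,V_1,\dots$ (generalized spherical harmonics), $h_k=\dim V_k$; with $\{\phi_{k,i}\}_{i=1}^{h_k}$ an orthonormal basis of $V_k$, the function $\frac1{h_k}\sum_i\phi_{k,i}(x)\overline{\phi_{k,i}(y)}$ depends only on $\tau(x,y)$ and equals $\Phi_k(\tau(x,y))$, where $\Phi_k$ (the zonal spherical function) is assumed to be a polynomial of degree $k$. Let $\tau_0=\tau(x,x)$, so $\Phi_k(\tau_0)=1$. For finite $X\subset M$, $D(X)=\{\tau(x,y): x,y\in X, x\ne y\}$. Put $N(M,s)=h_0+h_1+\cdots+h_{s-1}$.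 For a set $D=\{d_1,\dots,d_s\}$ of $s$ distinct values attained by $\tau$ on pairs of distinct points of $M$, let $K_i=\prod_{j\ne i}\frac{d_j-\tau_0}{d_j-d_i}$; $\mathfrak{D}(M,s)$ is the set of all such $D$ for which every $K_i$ is an integer. For such $D$: $H(D)=\sum_{i: f_i>0}h_i$, where $f(t)=\prod_{i=1}^s\frac{d_i-t}{d_i-\tau_0}=\sum_{i=0}^s f_i\Phi_i(t)$; and $L(D)=\max\{1+\alpha_1+\cdots+\alpha_s : \sum_{i=1}^s\alpha_i\Phi_k(d_i)\ge -1 \text{ for all } k\ge0,\ \alpha_i\ge0\}$ (Delsarte's linear programming bound). *)

theory Defs
  imports
    "HOL-Probability.Probability"
    "HOL-Algebra.Group_Action"
    "HOL-Computational_Algebra.Polynomial"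
    "HOL-Library.Function_Algebras"
begin

subsection \<open>Groups\<close>

definition compact_connected_group :: "('g, 'r) monoid_scheme \<Rightarrow> 'g topology \<Rightarrow> bool" where
  "compact_connected_group G T \<longleftrightarrow>
     group G \<and> topspace T = carrier G \<and>
     continuous_map (prod_topology T T) T (\<lambda>(a, b). a \<otimes>\<^bsub>G\<^esub> b) \<and>
     continuous_map T T (\<lambda>a. inv\<^bsub>G\<^esub> a) \<and>
     Hausdorff_space T \<and> compact_space T \<and> connected_space T"

definition finite_discrete_group :: "('g, 'r) monoid_scheme \<Rightarrow> 'g topology \<Rightarrow> bool" where
  "finite_discrete_group G T \<longleftrightarrow>
     group G \<and> finite (carrier G) \<and> T = discrete_topology (carrier G)"


subsection \<open>Connected Riemannian manifolds\<close>

primrec Ck_on :: "nat \<Rightarrow> 'a::euclidean_space set \<Rightarrow> ('a \<Rightarrow> 'b::real_normed_vector) \<Rightarrow> bool" where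
  "Ck_on 0 S = (\<lambda>f. continuous_on S f)"
| "Ck_on (Suc n) S = (\<lambda>f. f differentiable_on S \<and>
     (\<forall>b\<in>Basis. Ck_on n S (\<lambda>x. frechet_derivative f (at x) b)))"

definition smooth_on :: "'a::euclidean_space set \<Rightarrow> ('a \<Rightarrow> 'b::real_normed_vector) \<Rightarrow> bool" where
  "smooth_on S f \<longleftrightarrow> (\<forall>n. Ck_on n S f)"

type_synonym ('m, 'e) chart = "'m set \<times> ('m \<Rightarrow> 'e)"

definition transition :: "('m, 'e) chart \<Rightarrow> ('m, 'e) chart \<Rightarrow> 'e \<Rightarrow> 'e" where
  "transition c c' = snd c' \<circ> inv_into (fst c) (snd c)"

definition smooth_atlas :: "('m::metric_space, 'e::euclidean_space) chart set \<Rightarrow> bool" where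
  "smooth_atlas \<A> \<longleftrightarrow>
     (\<Union>c\<in>\<A>. fst c) = UNIV \<and>
     (\<forall>(U, \<xi>)\<in>\<A>. open U \<and> open (\<xi> ` U) \<and> homeomorphism U (\<xi> ` U) \<xi> (inv_into U \<xi>)) \<and>
     (\<forall>c\<in>\<A>. \<forall>c'\<in>\<A>. smooth_on (snd c ` (fst c \<inter> fst c')) (transition c c'))"

text \<open>
  A metric tensor is given by its coordinate expressions: \<open>g c p u v\<close> is the inner product at the
  point \<open>p\<close> of the tangent vectors whose coordinates in the chart \<open>c\<close> are \<open>u\<close> and \<open>v\<close>.
\<close>

type_synonym ('m, 'e) metric_tensor = "('m, 'e) chart \<Rightarrow> 'm \<Rightarrow> 'e \<Rightarrow> 'e \<Rightarrow> real"

definition riemannian_metric ::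
    "('m::metric_space, 'e::euclidean_space) chart set \<Rightarrow> ('m, 'e) metric_tensor \<Rightarrow> bool" where
  "riemannian_metric \<A> g \<longleftrightarrow>
     (\<forall>c\<in>\<A>. \<forall>p\<in>fst c. bilinear (g c p) \<and>
        (\<forall>u v. g c p u v = g c p v u) \<and> (\<forall>v. v \<noteq> 0 \<longrightarrow> g c p v v > 0)) \<and>
     (\<forall>c\<in>\<A>. \<forall>u v. smooth_on (snd c ` fst c) (\<lambda>z. g c (inv_into (fst c) (snd c) z) u v)) \<and>
     (\<forall>c\<in>\<A>. \<forall>c'\<in>\<A>. \<forall>p\<in>fst c \<inter> fst c'. \<forall>u v.
        g c p u v = g c' p (frechet_derivative (transition c c') (at (snd c p)) u)
                           (frechet_derivative (transition c c') (at (snd c p)) v))"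

definition connected_riemannian_manifold ::
    "('m::metric_space, 'e::euclidean_space) chart set \<Rightarrow> ('m, 'e) metric_tensor \<Rightarrow> bool" where
  "connected_riemannian_manifold \<A> g \<longleftrightarrow>
     smooth_atlas \<A> \<and> riemannian_metric \<A> g \<and> connected (UNIV :: 'm set)"

definition piecewise_C1_curve ::
    "('m::metric_space, 'e::euclidean_space) chart set \<Rightarrow> (real \<Rightarrow> 'm) \<Rightarrow> bool" where
  "piecewise_C1_curve \<A> \<gamma> \<longleftrightarrow> path \<gamma> \<and>
     (\<forall>(U, \<xi>)\<in>\<A>. \<forall>a b. 0 \<le> a \<longrightarrow> a \<le> b \<longrightarrow> b \<le> 1 \<longrightarrow> \<gamma> ` {a..b} \<subseteq> U \<longrightarrow>
        (\<xi> \<circ> \<gamma>) piecewise_C1_differentiable_on {a..b})"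

text \<open>The choice of the chart is immaterial by the compatibility of the coordinate expressions.\<close>

definition curve_speed ::
    "('m::metric_space, 'e::euclidean_space) chart set \<Rightarrow> ('m, 'e) metric_tensor \<Rightarrow>
     (real \<Rightarrow> 'm) \<Rightarrow> real \<Rightarrow> real" where
  "curve_speed \<A> g \<gamma> t =
     (let c = (SOME c. c \<in> \<A> \<and> \<gamma> t \<in> fst c);
          w = vector_derivative (snd c \<circ> \<gamma>) (at t)
      in sqrt (g c (\<gamma> t) w w))"

text \<open>
  The library's piecewise \<open>C\<^sup>1\<close> curves may have an unbounded derivative at the breakpoints, so
  the length is required to exist as an integral.
\<close>

definition riemannian_dist ::
    "('m::metric_space, 'e::euclidean_space) chart set \<Rightarrow> ('m, 'e) metric_tensor \<Rightarrow>
     'm \<Rightarrow> 'm \<Rightarrow> real" where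
  "riemannian_dist \<A> g x y =
     Inf {l. \<exists>\<gamma>. piecewise_C1_curve \<A> \<gamma> \<and> pathstart \<gamma> = x \<and> pathfinish \<gamma> = y \<and>
                 (curve_speed \<A> g \<gamma> has_integral l) {0..1}}"


subsection \<open>The graph of minimal distances\<close>

definition min_dist_graph :: "('m::metric_space \<times> 'm) set" where
  "min_dist_graph = {(x, y). x \<noteq> y \<and> dist x y = Min {dist u v |u v :: 'm. u \<noteq> v}}"

definition graph_dist :: "('m \<times> 'm) set \<Rightarrow> 'm \<Rightarrow> 'm \<Rightarrow> nat" where
  "graph_dist E x y = (LEAST n. (x, y) \<in> E ^^ n)"


subsection \<open>Function spaces\<close>

definition fun_scale :: "complex \<Rightarrow> ('m \<Rightarrow> complex) \<Rightarrow> 'm \<Rightarrow> complex" where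
  "fun_scale c f = (\<lambda>x. c * f x)"

global_interpretation cfun: vector_space "fun_scale :: complex \<Rightarrow> ('m \<Rightarrow> complex) \<Rightarrow> _"
  by unfold_locales (auto simp: fun_scale_def fun_eq_iff algebra_simps)

definition L2_fun :: "'m measure \<Rightarrow> ('m \<Rightarrow> complex) set" where
  "L2_fun \<mu> = {f \<in> borel_measurable \<mu>. integrable \<mu> (\<lambda>x. (cmod (f x))\<^sup>2)}"

definition L2_inner :: "'m measure \<Rightarrow> ('m \<Rightarrow> complex) \<Rightarrow> ('m \<Rightarrow> complex) \<Rightarrow> complex" where
  "L2_inner \<mu> f g = (LINT x|\<mu>. f x * cnj (g x))"

definition L2_orthonormal_basis ::
    "'m measure \<Rightarrow> ('m \<Rightarrow> complex) set \<Rightarrow> nat \<Rightarrow> (nat \<Rightarrow> 'm \<Rightarrow> complex) \<Rightarrow> bool" where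
  "L2_orthonormal_basis \<mu> V n e \<longleftrightarrow>
     (\<forall>i<n. \<forall>j<n. L2_inner \<mu> (e i) (e j) = (if i = j then 1 else 0)) \<and>
     cfun.span (e ` {..<n}) = V"


subsection \<open>Two-point-homogeneous spaces\<close>

text \<open>
  The space is the whole type \<open>'m\<close>, with the natural distance (up to a constant factor) \<open>dist\<close>.
  The real function \<open>\<tau>\<close> is a coordinate for this distance: \<open>\<tau> = dist\<close> is allowed, and so is, on
  the unit sphere, the inner product.  The latter is needed for the zonal spherical functions of the
  infinite spaces to be polynomials in \<open>\<tau>\<close>, and makes \<open>\<tau>0 = \<tau>(x, x)\<close> nonzero.

  \<open>I\<close> is the index set of the harmonic subspaces \<open>V k\<close>: all natural numbers for an infinite space
  and an initial segment for a finite one.  The elements of \<open>V k\<close> are continuous functions, as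
  their values at points are used.
\<close>

locale two_point_homogeneous_space =
  fixes G :: "('g, 'r) monoid_scheme"
    and T :: "'g topology"
    and act :: "'g \<Rightarrow> 'm::metric_space \<Rightarrow> 'm"
    and \<A> :: "('m, 'e::euclidean_space) chart set"
    and g :: "('m, 'e) metric_tensor"
    and \<tau> :: "'m \<Rightarrow> 'm \<Rightarrow> real"
    and \<tau>0 :: real
    and \<mu> :: "'m measure"
    and I :: "nat set"
    and V :: "nat \<Rightarrow> ('m \<Rightarrow> complex) set"
    and \<phi> :: "nat \<Rightarrow> nat \<Rightarrow> 'm \<Rightarrow> complex"
    and \<Phi> :: "nat \<Rightarrow> real poly"
  assumes group: "finite_discrete_group G T \<or> compact_connected_group G T"
    and action: "group_action G (UNIV :: 'm set) act"
    and continuous_action: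
      "continuous_map (prod_topology T euclidean) euclidean (\<lambda>(a, x). act a x)"
    and strongly_invariant:
      "\<And>x y x' y'. \<tau> x y = \<tau> x' y' \<longleftrightarrow> (\<exists>a\<in>carrier G. act a x = x' \<and> act a y = y')"
    and \<tau>_coordinate: "\<And>x y x' y'. \<tau> x y = \<tau> x' y' \<longleftrightarrow> dist x y = dist x' y'"
    and \<tau>0: "\<And>x. \<tau> x x = \<tau>0"
    and infinite_case: "infinite (carrier G) \<Longrightarrow>
      connected_riemannian_manifold \<A> g \<and>
      (\<exists>C>0. \<forall>x y. dist x y = C * riemannian_dist \<A> g x y)"
    and finite_case: "finite (carrier G) \<Longrightarrow>
      (\<exists>C>0. \<forall>x y :: 'm. (x, y) \<in> min_dist_graph\<^sup>* \<and>
                         dist x y = C * real (graph_dist min_dist_graph x y))"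
    and normalized: "prob_space \<mu>"
    and borel_measure: "sets \<mu> = sets borel"
    and invariant_measure: "\<And>a. a \<in> carrier G \<Longrightarrow> distr \<mu> borel (act a) = \<mu>"
    and index_infinite: "infinite (UNIV :: 'm set) \<Longrightarrow> I = UNIV"
    and index_finite: "finite (UNIV :: 'm set) \<Longrightarrow> \<exists>d. I = {..d}"
    and harmonics_subspace: "\<And>k. k \<in> I \<Longrightarrow> cfun.subspace (V k)"
    and harmonics_nonzero: "\<And>k. k \<in> I \<Longrightarrow> cfun.dim (V k) > 0"
    and harmonics_continuous: "\<And>k f. k \<in> I \<Longrightarrow> f \<in> V k \<Longrightarrow> continuous_on UNIV f"
    and harmonics_orthogonal:
      "\<And>k l u v. k \<in> I \<Longrightarrow> l \<in> I \<Longrightarrow> k \<noteq> l \<Longrightarrow> u \<in> V k \<Longrightarrow> v \<in> V l \<Longrightarrow> L2_inner \<mu> u v = 0"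
    and harmonics_sum: "\<And>f. f \<in> L2_fun \<mu> \<Longrightarrow>
      \<exists>v. (\<forall>k\<in>I. v k \<in> V k) \<and>
          (\<lambda>n. LINT x|\<mu>. (cmod (f x - (\<Sum>k\<in>I \<inter> {..<n}. v k x)))\<^sup>2) \<longlonglongrightarrow> 0"
    and orthonormal_basis: "\<And>k. k \<in> I \<Longrightarrow> L2_orthonormal_basis \<mu> (V k) (cfun.dim (V k)) (\<phi> k)"
    and zonal_degree: "\<And>k. k \<in> I \<Longrightarrow> degree (\<Phi> k) = k"
    and zonal: "\<And>k x y. k \<in> I \<Longrightarrow>
      (\<Sum>i<cfun.dim (V k). \<phi> k i x * cnj (\<phi> k i y)) / of_nat (cfun.dim (V k)) =
      complex_of_real (poly (\<Phi> k) (\<tau> x y))"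


subsection \<open>Distance sets and their bounds\<close>

definition distance_set :: "('m \<Rightarrow> 'm \<Rightarrow> real) \<Rightarrow> 'm set \<Rightarrow> real set" where
  "distance_set \<tau> X = {\<tau> x y |x y. x \<in> X \<and> y \<in> X \<and> x \<noteq> y}"

text \<open>
  Maxima are taken as suprema in \<^typ>\<open>ereal\<close>, so that no value is invented for the maximum over an
  empty or unbounded set.
\<close>

definition max_distance_set_card :: "('m \<Rightarrow> 'm \<Rightarrow> real) \<Rightarrow> nat \<Rightarrow> ereal" where
  "max_distance_set_card \<tau> s =
     (SUP X\<in>{X. finite X \<and> card (distance_set \<tau> X) = s}. ereal (real (card X)))"

definition harmonic_dim_sum :: "nat set \<Rightarrow> (nat \<Rightarrow> ('m \<Rightarrow> complex) set) \<Rightarrow> nat \<Rightarrow> nat" where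
  "harmonic_dim_sum I V s = (\<Sum>k\<in>I \<inter> {..<s}. cfun.dim (V k))"

definition LRS_ratio :: "real \<Rightarrow> real set \<Rightarrow> real \<Rightarrow> real" where
  "LRS_ratio \<tau>0 D a = (\<Prod>b\<in>D - {a}. (b - \<tau>0) / (b - a))"

definition integral_distance_sets :: "('m \<Rightarrow> 'm \<Rightarrow> real) \<Rightarrow> real \<Rightarrow> nat \<Rightarrow> real set set" where
  "integral_distance_sets \<tau> \<tau>0 s =
     {D. D \<subseteq> {\<tau> x y |x y. x \<noteq> y} \<and> finite D \<and> card D = s \<and> (\<forall>a\<in>D. LRS_ratio \<tau>0 D a \<in> \<int>)}"

definition annihilator_poly :: "real \<Rightarrow> real set \<Rightarrow> real poly" where
  "annihilator_poly \<tau>0 D = (\<Prod>a\<in>D. smult (1 / (a - \<tau>0)) [:a, -1:])"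

definition zonal_coeff :: "(nat \<Rightarrow> real poly) \<Rightarrow> real \<Rightarrow> real set \<Rightarrow> nat \<Rightarrow> real" where
  "zonal_coeff \<Phi> \<tau>0 D =
     (THE c. annihilator_poly \<tau>0 D = (\<Sum>i\<le>card D. smult (c i) (\<Phi> i)) \<and> (\<forall>i>card D. c i = 0))"

definition H_bound ::
    "(nat \<Rightarrow> ('m \<Rightarrow> complex) set) \<Rightarrow> (nat \<Rightarrow> real poly) \<Rightarrow> real \<Rightarrow> real set \<Rightarrow> nat" where
  "H_bound V \<Phi> \<tau>0 D = (\<Sum>i\<in>{i. i \<le> card D \<and> zonal_coeff \<Phi> \<tau>0 D i > 0}. cfun.dim (V i))"

definition L_bound :: "nat set \<Rightarrow> (nat \<Rightarrow> real poly) \<Rightarrow> real set \<Rightarrow> ereal" where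
  "L_bound I \<Phi> D =
     (SUP \<alpha>\<in>{\<alpha>. (\<forall>a\<in>D. \<alpha> a \<ge> 0) \<and> (\<forall>k\<in>I. (\<Sum>a\<in>D. \<alpha> a * poly (\<Phi> k) a) \<ge> -1)}.
        ereal (1 + (\<Sum>a\<in>D. \<alpha> a)))"

definition B_bound ::
    "nat set \<Rightarrow> (nat \<Rightarrow> ('m \<Rightarrow> complex) set) \<Rightarrow> (nat \<Rightarrow> real poly) \<Rightarrow> real \<Rightarrow> real set \<Rightarrow> ereal" where
  "B_bound I V \<Phi> \<tau>0 D = min (ereal (real (H_bound V \<Phi> \<tau>0 D))) (L_bound I \<Phi> D)"

end

(*
  The bounds by H and L are the usual linear algebra and linear programming arguments, both from
  positive semidefiniteness of the zonal kernels. The point is that card X >= 2N, with N = N(M,s),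
  forces each K_a to be an integer. Interpolation gives a polynomial F of degree s - 1 with
  F(tau0) = K_a, F(a) = 1 and F = 0 at the other distances, so A + K_a 1, with A the adjacency matrix
  of {tau = a} on X, has rank at most N <= card X / 2. Hence theta = -K_a is an eigenvalue of A, an
  algebraic integer. If it were irrational, it would have a conjugate theta', and A - theta' would
  also have rank at most N, because the minors are rational polynomials in theta. The two ranks force
  (A - theta)(A - theta') = 0. The diagonal of this identity shows that A is regular of degree
  d = -theta theta', and its row sums give (d - theta)(d - theta') = 0, a contradiction.
*)
theory Submission
  imports Defs "Jordan_Normal_Form.Char_Poly"
begin

subsection \<open>Integrality from low rank\<close>

text \<open>The minimal polynomial of \<open>\<theta>\<close> has degree at least 2 and
  \<open>\<theta>\<close> as a simple root, so it has a further root. The last clause is what later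
  carries vanishing minors from one number to the other.\<close>

lemma exists_conjugate:
  fixes \<theta> :: complex
  assumes alg: "algebraic_int \<theta>" and irr: "\<theta> \<notin> \<rat>"
  obtains \<theta>' where "\<theta>' \<noteq> \<theta>" "\<theta>' \<notin> \<rat>"
    "\<And>q :: rat poly. poly (map_poly of_rat q) \<theta> = 0 \<Longrightarrow> poly (map_poly of_rat q) \<theta>' = 0"
proof -
  interpret of_rat_poly_hom: map_poly_comm_ring_hom "of_rat :: rat \<Rightarrow> complex" ..
  let ?e = "\<lambda>q :: rat poly. map_poly of_rat q :: complex poly"
  define P where "P q \<longleftrightarrow> q \<noteq> 0 \<and> poly (?e q) \<theta> = 0" for q
  obtain q0 :: "int poly" where q0: "poly (map_poly of_int q0) \<theta> = 0" "lead_coeff q0 = 1"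
    using alg unfolding algebraic_int_altdef_ipoly by blast
  have "?e (map_poly of_int q0) = map_poly of_int q0"
    by (simp add: map_poly_map_poly o_def)
  then have "P (map_poly of_int q0)"
    using q0 by (auto simp: P_def)
  \<comment> \<open>A rational polynomial of least degree vanishing at \<open>\<theta>\<close>: the
    minimal polynomial up to a scalar.\<close>
  then obtain p where p: "P p" and least: "\<And>q. P q \<Longrightarrow> degree p \<le> degree q"
    using arg_min_nat_lemma[of P _ degree] by metis
  have p0: "p \<noteq> 0" and p\<theta>: "poly (?e p) \<theta> = 0"
    using p by (auto simp: P_def)
  have nonroot: "poly (?e q) \<theta> \<noteq> 0" if "q \<noteq> 0" "degree q < degree p" for q
    using least[of q] that by (auto simp: P_def)
  have dvd: "p dvd q" if "poly (?e q) \<theta> = 0" for q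
  proof -
    have "?e q = ?e (q div p) * ?e p + ?e (q mod p)"
      by (metis div_mult_mod_eq of_rat_poly_hom.hom_add of_rat_poly_hom.hom_mult)
    then have "poly (?e (q mod p)) \<theta> = 0"
      using that p\<theta> by simp
    then show ?thesis
      using nonroot[of "q mod p"] degree_mod_less'[OF p0, of q] by (auto simp: mod_eq_0_iff_dvd)
  qed
  have deg: "degree p \<ge> 2"
  proof (rule ccontr)
    assume "\<not> degree p \<ge> 2"
    then have "p = [:coeff p 0, coeff p 1:]"
      by (intro poly_eqI) (auto simp: coeff_pCons coeff_eq_0 split: nat.splits)
    then obtain a b where ab: "p = [:a, b:]" by blast
    then have "of_rat a + of_rat b * \<theta> = 0"
      using p\<theta> by (simp add: mult.commute of_rat_hom.map_poly_pCons_hom)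
    moreover have "b \<noteq> 0"
      using calculation p0 ab by auto
    ultimately have "\<theta> = of_rat (- a / b)"
      by (simp add: of_rat_divide of_rat_minus field_simps eq_neg_iff_add_eq_0)
    with irr show False by auto
  qed
  obtain r where r: "?e p = [:- \<theta>, 1:] * r"
    using p\<theta> by (metis poly_eq_0_iff_dvd dvdE)
  \<comment> \<open>By minimality \<open>pderiv p\<close>, nonzero and of lower degree, does not
    vanish at \<open>\<theta>\<close>. So \<open>\<theta>\<close> is a simple root, and the roots of
    \<open>r\<close> differ from it.\<close>
  have "poly (?e (pderiv p)) \<theta> \<noteq> 0"
    using deg by (intro nonroot) (auto simp: pderiv_eq_0_iff degree_pderiv)
  moreover have "?e (pderiv p) = pderiv (?e p)"
    by (rule of_rat_hom.map_poly_pderiv)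
  ultimately have r\<theta>: "poly r \<theta> \<noteq> 0"
    unfolding r pderiv_mult by (simp add: pderiv_pCons)
  have "degree (?e p) = 1 + degree r"
    unfolding r using r\<theta> by (subst degree_mult_eq) auto
  then have "\<not> constant (poly r)"
    using deg by (simp add: constant_degree)
  then obtain \<theta>' where \<theta>': "poly r \<theta>' = 0"
    using fundamental_theorem_of_algebra by blast
  then have p\<theta>': "poly (?e p) \<theta>' = 0"
    by (simp add: r)
  show thesis
  proof (rule that)
    show "\<theta>' \<noteq> \<theta>" using \<theta>' r\<theta> by auto
    show "\<theta>' \<notin> \<rat>"
    proof
      \<comment> \<open>A rational root would split off a linear factor over the rationals and leave
        a polynomial of lower degree vanishing at \<open>\<theta>\<close>.\<close>
      assume "\<theta>' \<in> \<rat>"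
      then obtain k where k: "\<theta>' = of_rat k" by (auto elim: Rats_cases)
      have "poly p k = 0" using p\<theta>' by (simp add: k)
      then obtain t where t: "p = [:- k, 1:] * t" by (metis poly_eq_0_iff_dvd dvdE)
      have "t \<noteq> 0" using p0 t by auto
      then have "degree t < degree p" unfolding t by (subst degree_mult_eq) auto
      then have "poly (?e t) \<theta> \<noteq> 0" using \<open>t \<noteq> 0\<close> by (intro nonroot)
      moreover have "?e p = ?e [:- k, 1:] * ?e t"
        unfolding t by (rule of_rat_poly_hom.hom_mult)
      then have "poly (?e p) \<theta> = (\<theta> - \<theta>') * poly (?e t) \<theta>"
        unfolding k by (simp only: poly_mult) (simp add: of_rat_hom.map_poly_pCons_hom of_rat_minus)
      ultimately show False using p\<theta> \<open>\<theta>' \<noteq> \<theta>\<close> by simp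
    qed
    fix q assume "poly (?e q) \<theta> = 0"
    then obtain t where "q = p * t" using dvd by (auto elim: dvdE)
    then show "poly (?e q) \<theta>' = 0" using p\<theta>' by (simp add: of_rat_poly_hom.hom_mult)
  qed
qed

section \<open>Rank bounds as factorizations and as vanishing minors\<close>

text \<open>Padding both factors to size \<open>Suc N\<close> gives the left one a zero column, so
  the product is singular.\<close>

lemma minor_eq_0_of_factorization:
  fixes u v :: "nat \<Rightarrow> nat \<Rightarrow> 'a :: field"
  assumes "\<And>i j. i < Suc N \<Longrightarrow> j < Suc N \<Longrightarrow> B i j = (\<Sum>k<N. u i k * v k j)"
  shows "det (mat (Suc N) (Suc N) (\<lambda>(i, j). B i j)) = 0"
proof -
  let ?U = "mat (Suc N) (Suc N) (\<lambda>(i, k). if k < N then u i k else 0)"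
  let ?V = "mat (Suc N) (Suc N) (\<lambda>(k, j). v k j)"
  have "mat (Suc N) (Suc N) (\<lambda>(i, j). B i j) = ?U * ?V"
    by (rule eq_matI) (auto simp: scalar_prod_def assms atLeast0LessThan)
  moreover have "?U *\<^sub>v unit_vec (Suc N) N = 0\<^sub>v (Suc N)"
    by (rule eq_vecI) (auto simp: scalar_prod_def unit_vec_def)
  then have "det ?U = 0"
    by (subst det_0_iff_vec_prod_zero_field[of _ "Suc N"]) (auto intro!: exI[of _ "unit_vec (Suc N) N"] simp: unit_vec_nonzero)
  ultimately show ?thesis
    by (simp add: det_mult[of _ "Suc N"])
qed

text \<open>Zero rows make the system square. Since \<open>H < n\<close> there is at least one of
  them, so the matrix is singular.\<close>

lemma nontrivial_kernel:
  fixes B :: "nat \<Rightarrow> nat \<Rightarrow> 'a :: field"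
  assumes "H < n"
  obtains c where "\<exists>j<n. c j \<noteq> 0" "\<And>i. i < H \<Longrightarrow> (\<Sum>j<n. B i j * c j) = 0"
proof -
  let ?U = "mat n n (\<lambda>(i, k). if i < H then B i k else 0)"
  have "transpose_mat ?U *\<^sub>v unit_vec n H = 0\<^sub>v n"
    using assms by (intro eq_vecI) (auto simp: scalar_prod_def unit_vec_def intro!: sum.neutral)
  then have "det (transpose_mat ?U) = 0"
    using assms by (subst det_0_iff_vec_prod_zero_field[of _ n])
      (auto intro!: exI[of _ "unit_vec n H"] simp: unit_vec_nonzero)
  then have "det ?U = 0"
    by (simp add: det_transpose[of _ n])
  then obtain w where w: "w \<in> carrier_vec n" "w \<noteq> 0\<^sub>v n" "?U *\<^sub>v w = 0\<^sub>v n"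
    by (subst (asm) det_0_iff_vec_prod_zero_field[of _ n]) auto
  show thesis
  proof (rule that[of "\<lambda>j. vec_index w j"])
    show "\<exists>j<n. vec_index w j \<noteq> 0"
      using w(1,2) by (metis carrier_vecD eq_vecI index_zero_vec)
    fix i assume "i < H"
    then show "(\<Sum>j<n. B i j * vec_index w j) = 0"
      using arg_cong[OF w(3), of "\<lambda>x. vec_index x i"] w(1) assms
      by (simp add: scalar_prod_def atLeast0LessThan)
  qed
qed

text \<open>Converse of \<open>minor_eq_0_of_factorization\<close>, by bordering. When every minor
  bordering a nonsingular submatrix vanishes, each column is a combination of the selected columns
  \<open>h k\<close>, which form the left factor. Repeated indices in \<open>f\<close> or
  \<open>h\<close> are harmless, as such a minor is 0 anyway.\<close>

lemma factorization_of_minors_eq_0: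
  fixes B :: "nat \<Rightarrow> nat \<Rightarrow> 'a :: field"
  assumes "\<And>f h. f ` {..N} \<subseteq> {..<n} \<Longrightarrow> h ` {..N} \<subseteq> {..<n} \<Longrightarrow>
    det (mat (Suc N) (Suc N) (\<lambda>(i, j). B (f i) (h j))) = 0"
  shows "\<exists>u v. \<forall>i<n. \<forall>j<n. B i j = (\<Sum>k<N. u i k * v k j)"
  using assms
proof (induction N)
  case 0
  have "B i j = 0" if "i < n" "j < n" for i j
    using 0[of "\<lambda>_. i" "\<lambda>_. j"] that by (simp add: det_single)
  then show ?case by simp
next
  case (Suc N)
  show ?case
  proof (cases "\<forall>f h. f ` {..N} \<subseteq> {..<n} \<longrightarrow> h ` {..N} \<subseteq> {..<n} \<longrightarrow>
      det (mat (Suc N) (Suc N) (\<lambda>(i, j). B (f i) (h j))) = 0")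
    case True
    then obtain u v where "\<forall>i<n. \<forall>j<n. B i j = (\<Sum>k<N. u i k * v k j)"
      using Suc.IH by blast
    then show ?thesis
      by (intro exI[of _ "\<lambda>i k. if k < N then u i k else 0"] exI[of _ v]) simp
  next
    case False
    then obtain f h where fh: "f ` {..N} \<subseteq> {..<n}" "h ` {..N} \<subseteq> {..<n}"
      and S: "det (mat (Suc N) (Suc N) (\<lambda>(i, j). B (f i) (h j))) \<noteq> 0"
      by blast
    let ?S = "mat (Suc N) (Suc N) (\<lambda>(i, j). B (f i) (h j))"
    \<comment> \<open>Injectivity of the submatrix serves twice: a kernel vector of the bordered
      matrix must involve the new column, and the coefficients of a column are determined by the
      rows \<open>f\<close> alone.\<close>
    have Sinj: "\<forall>k<Suc N. w k = 0"
      if "\<And>i. i < Suc N \<Longrightarrow> (\<Sum>k<Suc N. B (f i) (h k) * w k) = 0" for w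
    proof -
      have "?S *\<^sub>v vec (Suc N) w = 0\<^sub>v (Suc N)"
        using that by (intro eq_vecI) (auto simp: scalar_prod_def atLeast0LessThan)
      then have "vec (Suc N) w = 0\<^sub>v (Suc N)"
        using S det_0_iff_vec_prod_zero_field[of ?S "Suc N"] by (metis mat_carrier vec_carrier)
      then show ?thesis
        by (metis index_vec index_zero_vec(1))
    qed
    have sol: "\<exists>w. (\<forall>l<Suc N. (\<Sum>k<Suc N. B (f l) (h k) * w k) = B (f l) j) \<and>
        (\<Sum>k<Suc N. B i (h k) * w k) = B i j" if ij: "i < n" "j < n" for i j
    proof -
      let ?f = "f(Suc N := i)" and ?h = "h(Suc N := j)"
      have "?f ` {..Suc N} \<subseteq> {..<n}" "?h ` {..Suc N} \<subseteq> {..<n}"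
        using fh ij by (auto simp: image_subset_iff)
      then have "det (mat (Suc (Suc N)) (Suc (Suc N)) (\<lambda>(i, j). B (?f i) (?h j))) = 0"
        by (rule Suc.prems)
      then obtain w where w: "w \<in> carrier_vec (Suc (Suc N))" "w \<noteq> 0\<^sub>v (Suc (Suc N))"
        "mat (Suc (Suc N)) (Suc (Suc N)) (\<lambda>(i, j). B (?f i) (?h j)) *\<^sub>v w = 0\<^sub>v (Suc (Suc N))"
        by (subst (asm) det_0_iff_vec_prod_zero_field[of _ "Suc (Suc N)"]) auto
      define t where "t = vec_index w (Suc N)"
      have eq: "(\<Sum>k<Suc N. B (?f l) (h k) * vec_index w k) + B (?f l) j * t = 0" if "l < Suc (Suc N)" for l
      proof -
        have "(\<Sum>k<Suc (Suc N). B (?f l) (?h k) * vec_index w k) = 0"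
          using arg_cong[OF w(3), of "\<lambda>x. vec_index x l"] w(1) that
          by (simp add: scalar_prod_def atLeast0LessThan del: sum.lessThan_Suc)
        moreover have "(\<Sum>k<Suc N. B (?f l) (?h k) * vec_index w k) = (\<Sum>k<Suc N. B (?f l) (h k) * vec_index w k)"
          by (rule sum.cong) auto
        ultimately show ?thesis
          by (simp add: t_def)
      qed
      have "t \<noteq> 0"
      proof
        assume "t = 0"
        then have "(\<Sum>k<Suc N. B (f l) (h k) * vec_index w k) = 0" if "l < Suc N" for l
          using eq[of l] that by (simp del: sum.lessThan_Suc)
        from Sinj[OF this] \<open>t = 0\<close> have "\<forall>k<Suc (Suc N). vec_index w k = 0"
          by (simp add: t_def less_Suc_eq)
        then show False
          using w(1,2) by (metis carrier_vecD eq_vecI index_zero_vec)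
      qed
      have scale: "(\<Sum>k<Suc N. B (?f l) (h k) * (- vec_index w k / t)) = B (?f l) j" if "l < Suc (Suc N)" for l
      proof -
        have "(\<Sum>k<Suc N. B (?f l) (h k) * (- vec_index w k / t)) = - (\<Sum>k<Suc N. B (?f l) (h k) * vec_index w k) / t"
          unfolding sum_negf[symmetric] sum_divide_distrib by (rule sum.cong) auto
        also have "\<dots> = B (?f l) j"
          using eq[OF that] \<open>t \<noteq> 0\<close>
          by (simp add: field_simps add_eq_0_iff del: sum.lessThan_Suc)
        finally show ?thesis .
      qed
      show ?thesis
      proof (intro exI[of _ "\<lambda>k. - vec_index w k / t"] conjI allI impI)
        fix l assume "l < Suc N"
        then show "(\<Sum>k<Suc N. B (f l) (h k) * (- vec_index w k / t)) = B (f l) j"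
          using scale[of l] by (simp del: sum.lessThan_Suc)
      next
        show "(\<Sum>k<Suc N. B i (h k) * (- vec_index w k / t)) = B i j"
          using scale[of "Suc N"] by (simp del: sum.lessThan_Suc)
      qed
    qed
    \<comment> \<open>Chosen from the rows \<open>f\<close> only, hence independent of
      \<open>i\<close>; \<open>Sinj\<close> identifies it with the solution that \<open>sol\<close>
      provides for each \<open>i\<close>.\<close>
    define w where "w j = (SOME w. \<forall>l<Suc N. (\<Sum>k<Suc N. B (f l) (h k) * w k) = B (f l) j)" for j
    have Bw: "B i j = (\<Sum>k<Suc N. B i (h k) * w j k)" if ij: "i < n" "j < n" for i j
    proof -
      from sol[OF ij] obtain w' where w': "\<forall>l<Suc N. (\<Sum>k<Suc N. B (f l) (h k) * w' k) = B (f l) j"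
        "(\<Sum>k<Suc N. B i (h k) * w' k) = B i j" by blast
      have wj: "\<forall>l<Suc N. (\<Sum>k<Suc N. B (f l) (h k) * w j k) = B (f l) j"
        unfolding w_def by (rule someI[of _ w']) (rule w'(1))
      have "\<forall>k<Suc N. w' k - w j k = 0"
        using wj w'(1) by (intro Sinj) (simp add: right_diff_distrib sum_subtractf del: sum.lessThan_Suc)
      then have "(\<Sum>k<Suc N. B i (h k) * w j k) = (\<Sum>k<Suc N. B i (h k) * w' k)"
        by (intro sum.cong) auto
      with w'(2) show ?thesis by (simp del: sum.lessThan_Suc)
    qed
    show ?thesis
      by (intro exI[of _ "\<lambda>i k. B i (h k)"] exI[of _ "\<lambda>k j. w j k"] allI impI Bw)
  qed
qed

section \<open>Scalar shifts of adjacency matrices of low rank\<close>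

text \<open>Rank at most \<open>N\<close> appears as a factorization, the form in which spherical
  harmonics deliver it. Minors are the intermediate form that can be passed to a conjugate of
  \<open>- K\<close>.\<close>

lemma adjacency_plus_scalar_low_rank_imp_integer:
  fixes K :: complex and E :: "nat \<Rightarrow> nat \<Rightarrow> bool" and u v :: "nat \<Rightarrow> nat \<Rightarrow> complex"
  assumes n: "0 < n" "2 * N \<le> n"
    and sym: "\<And>i j. i < n \<Longrightarrow> j < n \<Longrightarrow> E i j \<longleftrightarrow> E j i"
    and irrefl: "\<And>i. i < n \<Longrightarrow> \<not> E i i"
    and uv: "\<And>i j. i < n \<Longrightarrow> j < n \<Longrightarrow>
      of_bool (E i j) + (if i = j then K else 0) = (\<Sum>k<N. u i k * v k j)"
  shows "K \<in> \<int>"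
proof (rule ccontr)
  assume "K \<notin> \<int>"
  define \<theta> where "\<theta> = - K"
  \<comment> \<open>\<open>B z\<close> is A - z for the adjacency matrix A of \<open>E\<close>; at
    \<open>\<theta>\<close> it is the matrix factored by hypothesis.\<close>
  define B where "B z i j = of_bool (E i j) - (if i = j then z else (0 :: complex))" for z i j
  \<comment> \<open>The minors of \<open>B z\<close> as rational polynomials in \<open>z\<close>,
    with \<open>[:0, 1:]\<close> standing for the variable.\<close>
  define q where "q f h m = det (mat m m (\<lambda>(i, j). [:of_bool (E (f i) (h j)):] -
      (if f i = h j then [:0, 1:] else (0 :: rat poly))))" for f h :: "nat \<Rightarrow> nat" and m
  have q: "poly (map_poly of_rat (q f h m)) z = det (mat m m (\<lambda>(i, j). B z (f i) (h j)))" for f h m z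
  proof -
    interpret of_rat_poly_hom: map_poly_comm_ring_hom "of_rat :: rat \<Rightarrow> complex" ..
    interpret ev: comm_ring_hom "\<lambda>p. poly (map_poly of_rat p) z"
      by unfold_locales (auto simp: hom_distribs)
    show ?thesis
      unfolding q_def ev.hom_det[symmetric]
      by (rule arg_cong[where f = det], rule eq_matI)
        (auto simp: B_def hom_distribs of_bool_def)
  qed
  have B\<theta>: "B \<theta> i j = (\<Sum>k<N. u i k * v k j)" if "i < n" "j < n" for i j
    using uv[OF that] by (auto simp: B_def \<theta>_def)
  have "N < n" using n by simp
  have "algebraic_int \<theta>"
  proof -
    let ?A = "mat n n (\<lambda>(i, j). of_bool (E i j)) :: int mat"
    \<comment> \<open>\<open>v\<close> has fewer rows than columns. A nonzero vector in its kernel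
      is an eigenvector of the adjacency matrix for \<open>\<theta>\<close>, which is thus a root of
      a monic integer polynomial.\<close>
    obtain c where c: "\<exists>j<n. c j \<noteq> 0" "\<And>i. i < N \<Longrightarrow> (\<Sum>j<n. v i j * c j) = 0"
      using nontrivial_kernel[OF \<open>N < n\<close>, of v] by blast
    have Bc: "(\<Sum>j<n. B \<theta> i j * c j) = 0" if "i < n" for i
    proof -
      have "(\<Sum>j<n. B \<theta> i j * c j) = (\<Sum>j<n. \<Sum>k<N. u i k * (v k j * c j))"
        by (intro sum.cong) (auto simp: B\<theta> that sum_distrib_right mult.assoc)
      also have "\<dots> = (\<Sum>k<N. u i k * (\<Sum>j<n. v k j * c j))"
        by (subst sum.swap) (simp add: sum_distrib_left)
      finally show ?thesis by (simp add: c(2))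
    qed
    have "eigenvector (map_mat of_int ?A) (vec n c) \<theta>"
      unfolding eigenvector_def
    proof (intro conjI)
      show "vec n c \<noteq> 0\<^sub>v (dim_row (map_mat of_int ?A))"
        using c(1) by (metis dim_row_mat(1) index_map_mat(2) index_vec index_zero_vec(1))
      show "map_mat of_int ?A *\<^sub>v vec n c = \<theta> \<cdot>\<^sub>v vec n c"
      proof (rule eq_vecI)
        fix i assume "i < dim_vec (\<theta> \<cdot>\<^sub>v vec n c)"
        then have i: "i < n" by simp
        have "(\<Sum>j<n. of_bool (E i j) * c j) = (\<Sum>j<n. B \<theta> i j * c j + (if i = j then \<theta> * c j else 0))"
          by (intro sum.cong) (auto simp: B_def algebra_simps)
        also have "\<dots> = \<theta> * c i"
          using i by (simp add: sum.distrib Bc)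
        finally show "vec_index (map_mat of_int ?A *\<^sub>v vec n c) i = vec_index (\<theta> \<cdot>\<^sub>v vec n c) i"
          using i by (simp add: scalar_prod_def atLeast0LessThan)
      qed simp
    qed simp
    then have "poly (char_poly (map_mat of_int ?A)) \<theta> = 0"
      by (subst eigenvalue_root_char_poly[of _ n, symmetric]) (auto simp: eigenvalue_def)
    then have "poly (map_poly of_int (char_poly ?A)) \<theta> = 0"
      by (simp add: of_int_hom.char_poly_hom[of _ n])
    moreover have "lead_coeff (char_poly ?A) = 1"
      using degree_monic_char_poly[of ?A n] by simp
    ultimately show ?thesis
      unfolding algebraic_int_altdef_ipoly by blast
  qed
  moreover have "\<theta> \<notin> \<int>"
    using \<open>K \<notin> \<int>\<close> by (simp add: \<theta>_def)
  ultimately have "\<theta> \<notin> \<rat>"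
    using rational_algebraic_int_is_int by blast
  with \<open>algebraic_int \<theta>\<close> obtain \<theta>' where \<theta>': "\<theta>' \<noteq> \<theta>" "\<theta>' \<notin> \<rat>"
    and conj: "\<And>q :: rat poly. poly (map_poly of_rat q) \<theta> = 0 \<Longrightarrow> poly (map_poly of_rat q) \<theta>' = 0"
    by (rule exists_conjugate) blast
  \<comment> \<open>The factorization at \<open>\<theta>\<close> kills all minors of size
    \<open>Suc N\<close>, \<open>conj\<close> carries this to \<open>\<theta>'\<close>, and
    vanishing minors give back a factorization.\<close>
  have "\<exists>u v. \<forall>i<n. \<forall>j<n. B \<theta>' i j = (\<Sum>k<N. u i k * v k j)"
  proof (rule factorization_of_minors_eq_0)
    fix f h :: "nat \<Rightarrow> nat"
    assume fh: "f ` {..N} \<subseteq> {..<n}" "h ` {..N} \<subseteq> {..<n}"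
    have "det (mat (Suc N) (Suc N) (\<lambda>(i, j). B \<theta> (f i) (h j))) = 0"
      using fh by (intro minor_eq_0_of_factorization[where u = "\<lambda>i. u (f i)" and v = "\<lambda>k j. v k (h j)"] B\<theta>)
        (auto simp: image_subset_iff less_Suc_eq_le)
    then show "det (mat (Suc N) (Suc N) (\<lambda>(i, j). B \<theta>' (f i) (h j))) = 0"
      unfolding q[symmetric] by (rule conj)
  qed
  then obtain u' v' where uv': "\<And>i j. i < n \<Longrightarrow> j < n \<Longrightarrow> B \<theta>' i j = (\<Sum>k<N. u' i k * v' k j)"
    by blast
  define \<delta> where "\<delta> = \<theta> - \<theta>'"
  have "\<delta> \<noteq> 0" using \<theta>'(1) by (simp add: \<delta>_def)
  \<comment> \<open>Both matrices factor through dimension \<open>N \<le> n / 2\<close> and differ by the scalar \<open>\<delta>\<close>, so stacking the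
    two factorizations yields an inverse pair, whose product in the other order is again scalar.\<close>
  let ?P = "mat n n (\<lambda>(i, k). if k < N then u' i k / \<delta> else if k < 2 * N then - u i (k - N) / \<delta> else 0)"
  let ?Q = "mat n n (\<lambda>(k, j). if k < N then v' k j else v (k - N) j)"
  \<comment> \<open>Both blocks fit because \<open>2 * N \<le> n\<close>; any indices from
    \<open>2 * N\<close> on contribute 0.\<close>
  have split: "(\<Sum>k<n. if k < N then a k else if k < 2 * N then b (k - N) else 0) = (\<Sum>k<N. a k) + (\<Sum>k<N. b k)"
    for a b :: "nat \<Rightarrow> complex"
  proof -
    have add: "(\<Sum>k<N + m. if k < N then a k else b (k - N)) = (\<Sum>k<N. a k) + (\<Sum>k<m. b k)" for m
      by (induction m) auto
    have "(\<Sum>k<n. if k < N then a k else if k < 2 * N then b (k - N) else 0) =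
        (\<Sum>k<N + N. if k < N then a k else b (k - N))"
      using n by (intro sum.mono_neutral_cong_right) auto
    also have "\<dots> = (\<Sum>k<N. a k) + (\<Sum>k<N. b k)"
      by (rule add)
    finally show ?thesis .
  qed
  have "?P * ?Q = 1\<^sub>m n"
  proof (rule eq_matI)
    fix i j assume "i < dim_row (1\<^sub>m n)" "j < dim_col (1\<^sub>m n)"
    then have ij: "i < n" "j < n" by auto
    have "index_mat (?P * ?Q) (i, j) =
        (\<Sum>k<n. if k < N then u' i k * v' k j / \<delta> else if k < 2 * N then - (u i (k - N) * v (k - N) j) / \<delta> else 0)"
      using ij by (auto simp: scalar_prod_def atLeast0LessThan intro!: sum.cong)
    also have "\<dots> = (B \<theta>' i j - B \<theta> i j) / \<delta>"
      unfolding split[of "\<lambda>k. u' i k * v' k j / \<delta>" "\<lambda>k. - (u i k * v k j) / \<delta>"]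
      by (simp add: uv' B\<theta> ij sum_negf diff_divide_distrib flip: sum_divide_distrib)
    also have "\<dots> = index_mat (1\<^sub>m n) (i, j)"
      using \<open>\<delta> \<noteq> 0\<close> ij by (auto simp: B_def \<delta>_def)
    finally show "index_mat (?P * ?Q) (i, j) = index_mat (1\<^sub>m n) (i, j)" .
  qed auto
  then have QP: "?Q * ?P = 1\<^sub>m n"
    by (rule mat_mult_left_right_inverse[rotated 2]) (rule mat_carrier)+
  \<comment> \<open>An off-diagonal block of \<open>?Q * ?P\<close>: row \<open>N + k\<close> of
    \<open>?Q\<close> lists \<open>v k j\<close>, and column \<open>l\<close> of \<open>?P\<close>
    lists \<open>u' j l / \<delta>\<close>.\<close>
  have vu': "(\<Sum>j<n. v k j * u' j l) = 0" if "k < N" "l < N" for k l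
  proof -
    have kl: "N + k < n" "l < n" using that n by auto
    have "index_mat (?Q * ?P) (N + k, l) = (\<Sum>j<n. v k j * u' j l / \<delta>)"
      using kl that by (auto simp: scalar_prod_def atLeast0LessThan intro!: sum.cong)
    moreover have "index_mat (?Q * ?P) (N + k, l) = 0"
      unfolding QP using kl that by simp
    ultimately show ?thesis
      using \<open>\<delta> \<noteq> 0\<close> by (simp flip: sum_divide_distrib)
  qed
  \<comment> \<open>The product has the form u (v u') v', and its middle factor vanishes.\<close>
  have BB: "(\<Sum>j<n. B \<theta> i j * B \<theta>' j m) = 0" if "i < n" "m < n" for i m
  proof -
    have "(\<Sum>j<n. B \<theta> i j * B \<theta>' j m) = (\<Sum>j<n. \<Sum>k<N. \<Sum>l<N. (u i k * v' l m) * (v k j * u' j l))"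
      using that by (intro sum.cong) (auto simp: B\<theta> uv' sum_product mult_ac)
    also have "\<dots> = (\<Sum>k<N. \<Sum>l<N. \<Sum>j<n. (u i k * v' l m) * (v k j * u' j l))"
      by (subst sum.swap, rule sum.cong[OF refl], rule sum.swap)
    also have "\<dots> = 0"
      by (simp add: vu' flip: sum_distrib_left)
    finally show ?thesis .
  qed
  define d where "d i = (\<Sum>j<n. of_bool (E i j) :: complex)" for i
  \<comment> \<open>A diagonal entry of the zero product: since \<open>E\<close> is symmetric and
    without loops, the mixed terms vanish, leaving the degree of \<open>i\<close> plus
    \<open>\<theta> * \<theta>'\<close>.\<close>
  have d: "d i = - (\<theta> * \<theta>')" if i: "i < n" for i
  proof -
    have "(\<Sum>j<n. B \<theta> i j * B \<theta>' j i) = (\<Sum>j<n. of_bool (E i j) + (if j = i then \<theta> * \<theta>' else 0))"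
      using i by (intro sum.cong) (auto simp: B_def irrefl sym)
    also have "\<dots> = d i + \<theta> * \<theta>'"
      using i by (simp add: sum.distrib d_def)
    finally show ?thesis
      using BB[OF i i] by (simp add: add_eq_0_iff)
  qed
  have row: "(\<Sum>m<n. B z i m) = - (\<theta> * \<theta>') - z" if "i < n" for z i
    using that by (simp add: B_def sum_subtractf d[symmetric] d_def)
  \<comment> \<open>With d the common degree, all row sums of \<open>B z\<close> are d - z. Summing
    row 0 of the zero product gives (d - \<theta>)(d - \<theta>') = 0, although d is rational and
    both numbers are irrational.\<close>
  have "0 = (\<Sum>m<n. \<Sum>j<n. B \<theta> 0 j * B \<theta>' j m)"
    using BB n by simp
  also have "\<dots> = (\<Sum>j<n. B \<theta> 0 j * (\<Sum>m<n. B \<theta>' j m))"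
    by (subst sum.swap) (simp add: sum_distrib_left)
  also have "\<dots> = (\<Sum>j<n. B \<theta> 0 j) * (- (\<theta> * \<theta>') - \<theta>')"
    by (simp add: row sum_distrib_right)
  also have "\<dots> = (- (\<theta> * \<theta>') - \<theta>) * (- (\<theta> * \<theta>') - \<theta>')"
    using n by (simp add: row)
  finally have "\<theta> = d 0 \<or> \<theta>' = d 0"
    using d[OF n(1)] by (metis mult_eq_0_iff eq_iff_diff_eq_0)
  moreover have "d 0 \<in> \<rat>"
    unfolding d_def by (intro Rats_sum) (auto simp: of_bool_def)
  ultimately show False
    using \<theta>'(2) \<open>\<theta> \<notin> \<rat>\<close> by auto
qed

section \<open>Transfer to arbitrary finite index sets\<close>

lemma nontrivial_kernel_on:
  fixes B :: "'r \<Rightarrow> 'x \<Rightarrow> 'a :: field"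
  assumes "finite R" "finite X" "card R < card X"
  obtains c where "\<exists>x\<in>X. c x \<noteq> 0" "\<And>r. r \<in> R \<Longrightarrow> (\<Sum>x\<in>X. B r x * c x) = 0"
proof -
  obtain \<rho> where \<rho>: "bij_betw \<rho> {..<card R} R"
    using ex_bij_betw_nat_finite[OF \<open>finite R\<close>] by (auto simp: atLeast0LessThan)
  obtain \<xi> where \<xi>: "bij_betw \<xi> {..<card X} X"
    using ex_bij_betw_nat_finite[OF \<open>finite X\<close>] by (auto simp: atLeast0LessThan)
  obtain c where c: "\<exists>j<card X. c j \<noteq> 0"
    "\<And>i. i < card R \<Longrightarrow> (\<Sum>j<card X. B (\<rho> i) (\<xi> j) * c j) = 0"
    using nontrivial_kernel[OF assms(3), of "\<lambda>i j. B (\<rho> i) (\<xi> j)"] by blast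
  let ?c = "\<lambda>x. c (inv_into {..<card X} \<xi> x)"
  have inv: "?c (\<xi> j) = c j" if "j < card X" for j
    using \<xi> that by (simp add: bij_betw_def)
  show thesis
  proof (rule that[of ?c])
    show "\<exists>x\<in>X. ?c x \<noteq> 0"
      using c(1) inv \<xi> by (metis bij_betwE lessThan_iff)
    fix r assume "r \<in> R"
    then obtain i where i: "i < card R" "r = \<rho> i"
      using \<rho> by (auto simp: bij_betw_def)
    have "(\<Sum>x\<in>X. B r x * ?c x) = (\<Sum>j<card X. B r (\<xi> j) * ?c (\<xi> j))"
      by (rule sum.reindex_bij_betw[OF \<xi>, symmetric])
    then show "(\<Sum>x\<in>X. B r x * ?c x) = 0"
      using c(2)[OF i(1)] by (simp add: i inv)
  qed
qed

text \<open>\<open>R\<close> is meant to index harmonics of several degrees and \<open>X\<close> to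
  be a set of points, so the matrix result is carried over along enumerations of both.\<close>

lemma adjacency_plus_scalar_low_rank_imp_integer_on:
  fixes K :: complex and E :: "'x \<Rightarrow> 'x \<Rightarrow> bool"
    and u :: "'x \<Rightarrow> 'r \<Rightarrow> complex" and v :: "'r \<Rightarrow> 'x \<Rightarrow> complex"
  assumes "finite X" "X \<noteq> {}" "finite R" "2 * card R \<le> card X"
    and sym: "\<And>x y. x \<in> X \<Longrightarrow> y \<in> X \<Longrightarrow> E x y \<longleftrightarrow> E y x"
    and irrefl: "\<And>x. x \<in> X \<Longrightarrow> \<not> E x x"
    and uv: "\<And>x y. x \<in> X \<Longrightarrow> y \<in> X \<Longrightarrow>
      of_bool (E x y) + (if x = y then K else 0) = (\<Sum>r\<in>R. u x r * v r y)"
  shows "K \<in> \<int>"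
proof -
  obtain \<rho> where \<rho>: "bij_betw \<rho> {..<card R} R"
    using ex_bij_betw_nat_finite[OF \<open>finite R\<close>] by (auto simp: atLeast0LessThan)
  obtain \<xi> where \<xi>: "bij_betw \<xi> {..<card X} X"
    using ex_bij_betw_nat_finite[OF \<open>finite X\<close>] by (auto simp: atLeast0LessThan)
  have \<xi>X: "\<xi> i \<in> X" if "i < card X" for i
    using \<xi> that by (auto simp: bij_betw_def)
  have \<xi>_eq: "\<xi> i = \<xi> j \<longleftrightarrow> i = j" if "i < card X" "j < card X" for i j
    using \<xi> that by (auto simp: bij_betw_def inj_on_def)
  show ?thesis
  proof (rule adjacency_plus_scalar_low_rank_imp_integer[where E = "\<lambda>i j. E (\<xi> i) (\<xi> j)"
        and n = "card X" and N = "card R" and u = "\<lambda>i k. u (\<xi> i) (\<rho> k)" and v = "\<lambda>k j. v (\<rho> k) (\<xi> j)"])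
    show "0 < card X" using assms by (simp add: card_gt_0_iff)
    fix i j assume ij: "i < card X" "j < card X"
    show "of_bool (E (\<xi> i) (\<xi> j)) + (if i = j then K else 0) =
        (\<Sum>k<card R. u (\<xi> i) (\<rho> k) * v (\<rho> k) (\<xi> j))"
      using uv[OF \<xi>X[OF ij(1)] \<xi>X[OF ij(2)]] ij
        sum.reindex_bij_betw[OF \<rho>, of "\<lambda>r. u (\<xi> i) r * v r (\<xi> j)"]
      by (simp add: \<xi>_eq)
  qed (use assms(4) sym irrefl \<xi>X in auto)
qed

section \<open>Expansions in polynomials of successive degrees\<close>

text \<open>Subtracting the multiple of \<open>P (Suc s)\<close> that cancels the top coefficient
  lowers the degree bound. That \<open>P 0\<close> is nonzero is a separate condition because the
  zero polynomial also has degree 0.\<close>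

lemma graded_expansion_exists:
  fixes P :: "nat \<Rightarrow> 'a :: field poly"
  assumes "\<And>i. i \<le> s \<Longrightarrow> degree (P i) = i" "P 0 \<noteq> 0" "degree f \<le> s"
  shows "\<exists>c. f = (\<Sum>i\<le>s. Polynomial.smult (c i) (P i))"
  using assms
proof (induction s arbitrary: f)
  case 0
  then obtain a b where "f = [:a:]" "P 0 = [:b:]"
    by (metis degree_eq_zeroE le_zero_eq)
  with 0 show ?case by (intro exI[of _ "\<lambda>_. a / b"]) auto
next
  case (Suc s)
  define a where "a = coeff f (Suc s) / lead_coeff (P (Suc s))"
  have deg: "degree (P (Suc s)) = Suc s" using Suc.prems(1) by simp
  then have "lead_coeff (P (Suc s)) \<noteq> 0" by (metis degree_0 leading_coeff_0_iff nat.distinct(1))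
  then have "coeff (f - Polynomial.smult a (P (Suc s))) (Suc s) = 0"
    by (simp add: a_def deg)
  moreover have "degree (f - Polynomial.smult a (P (Suc s))) \<le> Suc s"
    using Suc.prems(3) deg by (intro degree_diff_le) (auto intro: order.trans[OF degree_smult_le])
  ultimately have "degree (f - Polynomial.smult a (P (Suc s))) \<le> s"
    by (metis degree_le coeff_eq_0 le_less_Suc_eq linorder_not_less not_less_eq)
  then obtain c where c: "f - Polynomial.smult a (P (Suc s)) = (\<Sum>i\<le>s. Polynomial.smult (c i) (P i))"
    using Suc.IH[of "f - Polynomial.smult a (P (Suc s))"] Suc.prems by auto
  have "f = (\<Sum>i\<le>s. Polynomial.smult (c i) (P i)) + Polynomial.smult a (P (Suc s))"
    by (simp flip: c)
  then show ?case
    by (intro exI[of _ "c(Suc s := a)"]) (auto intro!: sum.cong)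
qed

text \<open>Only the last polynomial contributes to the top coefficient, so its factor vanishes and
  induction applies to the rest.\<close>

lemma graded_expansion_unique:
  fixes P :: "nat \<Rightarrow> 'a :: field poly"
  assumes "\<And>i. i \<le> s \<Longrightarrow> degree (P i) = i" "P 0 \<noteq> 0" "(\<Sum>i\<le>s. Polynomial.smult (c i) (P i)) = 0" "i \<le> s"
  shows "c i = 0"
  using assms
proof (induction s)
  case 0
  then show ?case by simp
next
  case (Suc s)
  have deg: "degree (P (Suc s)) = Suc s" using Suc.prems(1) by simp
  then have lead: "coeff (P (Suc s)) (Suc s) \<noteq> 0"
    by (metis degree_0 leading_coeff_0_iff nat.distinct(1))
  have "coeff (P i) (Suc s) = 0" if "i \<le> s" for i
    using that Suc.prems(1)[of i] by (intro coeff_eq_0) auto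
  then have "coeff (\<Sum>i\<le>Suc s. Polynomial.smult (c i) (P i)) (Suc s) = c (Suc s) * coeff (P (Suc s)) (Suc s)"
    by (simp add: coeff_sum)
  then have "c (Suc s) = 0"
    using lead by (simp only: Suc.prems(3)) simp
  then show ?case
    using Suc by (cases "i = Suc s") auto
qed

subsection \<open>Zonal spherical functions\<close>

context two_point_homogeneous_space
begin

abbreviation h :: "nat \<Rightarrow> nat" where "h k \<equiv> cfun.dim (V k)"

lemma \<tau>_commute: "\<tau> x y = \<tau> y x"
  by (simp add: \<tau>_coordinate dist_commute)

lemma \<tau>_eq_\<tau>0_iff: "\<tau> x y = \<tau>0 \<longleftrightarrow> x = y"
  using \<tau>_coordinate[of x y x x] by (auto simp: \<tau>0)

lemma index_down_closed: "k \<in> I \<Longrightarrow> j \<le> k \<Longrightarrow> j \<in> I"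
  using index_infinite index_finite by (cases "finite (UNIV :: 'm set)") auto

lemma zero_in_index: "0 \<in> I"
  using index_infinite index_finite by (cases "finite (UNIV :: 'm set)") auto

lemma addition_formula:
  assumes "k \<in> I"
  shows "(\<Sum>i<h k. \<phi> k i x * cnj (\<phi> k i y)) = of_real (real (h k) * poly (\<Phi> k) (\<tau> x y))"
  using zonal[OF assms, of x y] harmonics_nonzero[OF assms] by (simp add: field_simps)

lemma orthonormal:
  assumes "k \<in> I" "i < h k" "j < h k"
  shows "L2_inner \<mu> (\<phi> k i) (\<phi> k j) = (if i = j then 1 else 0)"
  using orthonormal_basis[OF assms(1)] assms by (auto simp: L2_orthonormal_basis_def)

lemma harmonics_span: "k \<in> I \<Longrightarrow> cfun.span (\<phi> k ` {..<h k}) = V k"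
  using orthonormal_basis by (auto simp: L2_orthonormal_basis_def)

text \<open>Integrate \<open>addition_formula\<close> on the diagonal: the left side gives 1 for
  each basis function, and the right side is constant.\<close>

lemma zonal_\<tau>0:
  assumes k: "k \<in> I"
  shows "poly (\<Phi> k) \<tau>0 = 1"
proof -
  interpret prob_space \<mu> by (rule normalized)
  have one: "(LINT x|\<mu>. \<phi> k i x * cnj (\<phi> k i x)) = 1" if "i < h k" for i
    using orthonormal[OF k that that] by (simp add: L2_inner_def)
  \<comment> \<open>Each summand is integrable because its integral is 1, whereas a nonintegrable
    function has integral 0 by convention.\<close>
  have "(LINT x|\<mu>. (\<Sum>i<h k. \<phi> k i x * cnj (\<phi> k i x))) = (\<Sum>i<h k. (LINT x|\<mu>. \<phi> k i x * cnj (\<phi> k i x)))"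
    using one not_integrable_integral_eq by (intro Bochner_Integration.integral_sum) fastforce
  also have "\<dots> = of_nat (h k)"
    by (simp add: one)
  finally have "complex_of_real (real (h k) * poly (\<Phi> k) \<tau>0) = of_nat (h k)"
    by (simp add: addition_formula[OF k] \<tau>0 prob_space)
  then have "of_real (real (h k) * poly (\<Phi> k) \<tau>0) = complex_of_real (real (h k))"
    by simp
  then have "real (h k) * poly (\<Phi> k) \<tau>0 = real (h k)"
    by (simp only: of_real_eq_iff)
  then show ?thesis
    using harmonics_nonzero[OF k] by simp
qed

lemma zonal_0_nonzero: "\<Phi> 0 \<noteq> 0"
  using zonal_\<tau>0[OF zero_in_index] by auto

text \<open>Exhibits the zonal kernel as positive semidefinite. The squares are kept explicit
  because \<open>card_le_H_bound\<close> makes some of them vanish.\<close>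

lemma zonal_quadratic_form:
  assumes k: "k \<in> I"
  shows "(\<Sum>x\<in>X. \<Sum>y\<in>X. c x * cnj (c y) * of_real (poly (\<Phi> k) (\<tau> x y))) =
    of_real ((\<Sum>i<h k. (cmod (\<Sum>x\<in>X. c x * \<phi> k i x))\<^sup>2) / real (h k))"
proof -
  have "(\<Sum>x\<in>X. \<Sum>y\<in>X. c x * cnj (c y) * of_real (poly (\<Phi> k) (\<tau> x y))) =
      (\<Sum>x\<in>X. \<Sum>y\<in>X. \<Sum>i<h k. (c x * \<phi> k i x) * cnj (c y * \<phi> k i y)) / of_nat (h k)"
    unfolding zonal[OF k, symmetric] sum_divide_distrib sum_distrib_left
    by (intro sum.cong) auto
  also have "(\<Sum>x\<in>X. \<Sum>y\<in>X. \<Sum>i<h k. (c x * \<phi> k i x) * cnj (c y * \<phi> k i y)) =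
      (\<Sum>i<h k. \<Sum>x\<in>X. \<Sum>y\<in>X. (c x * \<phi> k i x) * cnj (c y * \<phi> k i y))"
    by (subst sum.swap, subst (2) sum.swap, subst sum.swap) (rule sum.cong[OF refl], rule sum.swap)
  also have "\<dots> = (\<Sum>i<h k. of_real ((cmod (\<Sum>x\<in>X. c x * \<phi> k i x))\<^sup>2))"
    unfolding complex_norm_square by (simp add: sum_product)
  finally show ?thesis by simp
qed

section \<open>Finite spaces: point masses and the identity kernel\<close>

context
  assumes finite_space: "finite (UNIV :: 'm set)"
begin

lemma all_sets: "A \<in> sets \<mu>"
proof -
  have "finite A" by (rule finite_subset[OF subset_UNIV finite_space])
  then show ?thesis
    unfolding borel_measure by (intro borel_closed finite_imp_closed)
qed

lemma all_measurable: "f \<in> measurable \<mu> N" if "space N = UNIV"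
  using that by (intro measurableI all_sets) auto

lemma has_bochner_integral_finite_space:
  fixes f :: "'m \<Rightarrow> 'b :: {banach, second_countable_topology}"
  shows "has_bochner_integral \<mu> f (\<Sum>y\<in>UNIV. measure \<mu> {y} *\<^sub>R f y)"
proof -
  interpret prob_space \<mu> by (rule normalized)
  have "has_bochner_integral \<mu> (\<lambda>x. \<Sum>y\<in>UNIV. indicator {y} x *\<^sub>R f y) (\<Sum>y\<in>UNIV. measure \<mu> {y} *\<^sub>R f y)"
    by (intro has_bochner_integral_sum has_bochner_integral_indicator all_sets)
      (simp add: emeasure_eq_measure)
  moreover have "(\<Sum>y\<in>UNIV. indicator {y} x *\<^sub>R f y) = f x" for x
  proof -
    have "(\<Sum>y\<in>UNIV. indicator {y} x *\<^sub>R f y) = (\<Sum>y\<in>UNIV. if x = y then f y else 0)"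
      by (intro sum.cong) (auto simp: indicator_def)
    then show ?thesis
      using finite_space by simp
  qed
  ultimately show ?thesis by simp
qed

text \<open>\<open>G\<close> is transitive on points: strong invariance applies to the pairs (x, x)
  and (y, y), on which \<open>\<tau>\<close> has the same value \<open>\<tau>0\<close>.\<close>

lemma measure_singleton_eq: "measure \<mu> {x} = measure \<mu> {y}"
proof -
  obtain a where a: "a \<in> carrier G" "act a x = y"
    using strongly_invariant[of x x y y] \<tau>0 by auto
  have "measure \<mu> {y} = measure (distr \<mu> borel (act a)) {y}"
    by (simp add: invariant_measure[OF a(1)])
  also have "\<dots> = measure \<mu> (act a -` {y} \<inter> space \<mu>)"
    by (intro measure_distr all_measurable) auto
  also have "act a -` {y} \<inter> space \<mu> = {x}"
    using a group_action.inj_prop[OF action a(1)] sets_eq_imp_space_eq[OF borel_measure]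
    by (auto simp: inj_on_def)
  finally show ?thesis ..
qed

lemma measure_singleton_pos: "measure \<mu> {x} > 0"
proof (rule ccontr)
  assume "\<not> measure \<mu> {x} > 0"
  then have "measure \<mu> {y} = 0" for y
    using measure_singleton_eq[of x y] measure_nonneg[of \<mu> "{x}"] by linarith
  then have "(LINT x|\<mu>. (1 :: real)) = 0"
    using has_bochner_integral_integral_eq[OF has_bochner_integral_finite_space[of "\<lambda>_. 1 :: real"]] by simp
  then show False
    using prob_space.prob_space[OF normalized] by simp
qed

text \<open>The function with value 1 at \<open>x\<close> and 0 elsewhere has coefficient
  \<open>m * cnj (\<phi> k i x)\<close> at \<open>\<phi> k i\<close>, where \<open>m\<close> is the
  mass of a point. By the addition formula its expansion at \<open>y\<close> is \<open>m\<close>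
  times the sum in question.\<close>

lemma reproducing_kernel_sum_eq_0:
  assumes "x \<noteq> y"
  shows "(\<Sum>k\<in>I. real (h k) * poly (\<Phi> k) (\<tau> x y)) = 0"
proof -
  define m where "m = measure \<mu> {x}"
  have m: "measure \<mu> {z} = m" for z
    unfolding m_def by (rule measure_singleton_eq)
  have "m > 0"
    unfolding m_def by (rule measure_singleton_pos)
  have inner: "L2_inner \<mu> w u = (\<Sum>z\<in>UNIV. m *\<^sub>R (w z * cnj (u z)))" for w u
    unfolding L2_inner_def has_bochner_integral_integral_eq[OF has_bochner_integral_finite_space] m ..
  obtain d where I: "I = {..d}"
    using index_finite[OF finite_space] by blast
  let ?f = "\<lambda>z. if z = x then 1 else 0 :: complex"
  have "?f \<in> L2_fun \<mu>"
    unfolding L2_fun_def using has_bochner_integral_finite_space has_bochner_integral_iff by (auto intro!: all_measurable)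
  then obtain v where v: "\<And>k. k \<in> I \<Longrightarrow> v k \<in> V k"
    and lim: "(\<lambda>n. LINT z|\<mu>. (cmod (?f z - (\<Sum>k\<in>I \<inter> {..<n}. v k z)))\<^sup>2) \<longlonglongrightarrow> 0"
    using harmonics_sum by blast
  have "\<forall>\<^sub>F n in sequentially. I \<inter> {..<n} = I"
    using eventually_gt_at_top[of d] by eventually_elim (auto simp: I)
  then have "\<forall>\<^sub>F n in sequentially. (LINT z|\<mu>. (cmod (?f z - (\<Sum>k\<in>I \<inter> {..<n}. v k z)))\<^sup>2) =
      (LINT z|\<mu>. (cmod (?f z - (\<Sum>k\<in>I. v k z)))\<^sup>2)"
    by eventually_elim simp
  \<comment> \<open>\<open>I\<close> is finite, so the partial sums are eventually the full sum and
    the limit says that the squared error has integral 0.\<close>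
  with lim have "(\<lambda>n. LINT z|\<mu>. (cmod (?f z - (\<Sum>k\<in>I. v k z)))\<^sup>2) \<longlonglongrightarrow> 0"
    using tendsto_cong by fast
  then have "(LINT z|\<mu>. (cmod (?f z - (\<Sum>k\<in>I. v k z)))\<^sup>2) = 0"
    using LIMSEQ_unique tendsto_const by blast
  then have "(\<Sum>z\<in>UNIV. m * (cmod (?f z - (\<Sum>k\<in>I. v k z)))\<^sup>2) = 0"
    unfolding has_bochner_integral_integral_eq[OF has_bochner_integral_finite_space] m by simp
  \<comment> \<open>Every point has positive mass, so an error of norm 0 vanishes at each
    point.\<close>
  then have f: "?f z = (\<Sum>k\<in>I. v k z)" for z
    using finite_space \<open>m > 0\<close> by (subst (asm) sum_nonneg_eq_0_iff) auto
  have expand: "w z = (\<Sum>i<h k. L2_inner \<mu> w (\<phi> k i) * \<phi> k i z)" if k: "k \<in> I" and w: "w \<in> V k" for w k z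
  proof -
    have "w \<in> cfun.span (\<phi> k ` {..<h k})"
      using harmonics_span[OF k] w by simp
    then have "\<forall>z. w z = (\<Sum>i<h k. L2_inner \<mu> w (\<phi> k i) * \<phi> k i z)"
    proof (induction rule: cfun.span_induct_alt)
      case base
      show ?case by (simp add: inner)
    next
      case (step c u w)
      then obtain j where j: "j < h k" "u = \<phi> k j" by auto
      have add: "L2_inner \<mu> (fun_scale c u + w) u' = c * L2_inner \<mu> u u' + L2_inner \<mu> w u'" for u'
        by (simp add: inner fun_scale_def algebra_simps sum.distrib sum_distrib_left)
      have u: "(\<Sum>i<h k. L2_inner \<mu> u (\<phi> k i) * \<phi> k i z) = u z" for z
      proof -
        have "(\<Sum>i<h k. L2_inner \<mu> u (\<phi> k i) * \<phi> k i z) = (\<Sum>i<h k. if j = i then \<phi> k i z else 0)"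
          by (intro sum.cong) (auto simp: j orthonormal[OF k])
        then show ?thesis using j by simp
      qed
      have w: "(\<Sum>i<h k. L2_inner \<mu> w (\<phi> k i) * \<phi> k i z) = w z" for z
        using step(2) by metis
      have "(\<Sum>i<h k. L2_inner \<mu> (fun_scale c u + w) (\<phi> k i) * \<phi> k i z) = c * u z + w z" for z
        unfolding add distrib_right sum.distrib mult.assoc by (simp only: u w flip: sum_distrib_left)
      moreover have "(fun_scale c u + w) z = c * u z + w z" for z
        by (simp add: fun_scale_def)
      ultimately show ?case by metis
    qed
    then show ?thesis by blast
  qed
  have inner_f: "L2_inner \<mu> (v k) (\<phi> k i) = m *\<^sub>R cnj (\<phi> k i x)" if k: "k \<in> I" and i: "i < h k" for k i
  proof -
    have \<phi>V: "\<phi> k i \<in> V k"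
      using i cfun.span_base[of "\<phi> k i" "\<phi> k ` {..<h k}"] harmonics_span[OF k] by auto
    have "m *\<^sub>R cnj (\<phi> k i x) = (\<Sum>z\<in>UNIV. m *\<^sub>R (?f z * cnj (\<phi> k i z)))"
      using finite_space by (simp add: if_distrib[of "\<lambda>t. t * _"] if_distrib[of "(*\<^sub>R) m"] cong: if_cong)
    also have "\<dots> = (\<Sum>l\<in>I. L2_inner \<mu> (v l) (\<phi> k i))"
      unfolding inner f by (subst sum.swap) (simp add: sum_distrib_right scaleR_sum_right)
    also have "\<dots> = (\<Sum>l\<in>I. if l = k then L2_inner \<mu> (v k) (\<phi> k i) else 0)"
      using harmonics_orthogonal[OF _ k _ v \<phi>V] by (intro sum.cong) auto
    also have "\<dots> = L2_inner \<mu> (v k) (\<phi> k i)"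
      using k by (simp add: I)
    finally show ?thesis ..
  qed
  have "0 = (\<Sum>k\<in>I. v k y)"
    using f[of y] assms by simp
  also have "\<dots> = (\<Sum>k\<in>I. \<Sum>i<h k. L2_inner \<mu> (v k) (\<phi> k i) * \<phi> k i y)"
    by (intro sum.cong refl expand v)
  also have "\<dots> = (\<Sum>k\<in>I. of_real m * (\<Sum>i<h k. \<phi> k i y * cnj (\<phi> k i x)))"
    by (intro sum.cong refl) (simp add: inner_f sum_distrib_left scaleR_conv_of_real mult_ac)
  also have "\<dots> = complex_of_real (m * (\<Sum>k\<in>I. real (h k) * poly (\<Phi> k) (\<tau> x y)))"
    by (simp add: addition_formula \<tau>_commute[of y x] flip: sum_distrib_left)
  finally show ?thesis
    using \<open>m > 0\<close> by (metis mult_eq_0_iff of_real_eq_0_iff less_irrefl)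
qed

end

text \<open>On a finite space \<open>\<Sum>k\<in>I. h k * \<Phi> k\<close> represents the kernel of the identity, so the distances between
  distinct points are among its roots.\<close>
lemma card_distances_in_index:
  assumes "D \<subseteq> {\<tau> x y |x y. x \<noteq> y}"
  shows "card D \<in> I"
proof (cases "finite (UNIV :: 'm set)")
  case False
  then show ?thesis by (simp add: index_infinite)
next
  case True
  then obtain d where I: "I = {..d}"
    using index_finite by blast
  define P where "P = (\<Sum>k\<in>I. Polynomial.smult (real (h k)) (\<Phi> k))"
  have poly_P: "poly P t = (\<Sum>k\<in>I. real (h k) * poly (\<Phi> k) t)" for t
    by (simp add: P_def poly_sum)
  \<comment> \<open>At \<open>\<tau>0\<close> the polynomial \<open>P\<close> takes the sum of the
    dimensions as its value, so it is nonzero and has at most \<open>d\<close> roots.\<close>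
  have "poly P \<tau>0 = (\<Sum>k\<in>I. real (h k))"
    by (simp add: poly_P zonal_\<tau>0)
  moreover have "(\<Sum>k\<in>I. real (h k)) > 0"
    using zero_in_index harmonics_nonzero by (intro sum_pos) (auto simp: I)
  ultimately have "P \<noteq> 0" by auto
  have "D \<subseteq> {t. poly P t = 0}"
    using assms reproducing_kernel_sum_eq_0[OF True] by (auto simp: poly_P)
  then have "card D \<le> card {t. poly P t = 0}"
    using poly_roots_finite[OF \<open>P \<noteq> 0\<close>] by (intro card_mono)
  also have "\<dots> \<le> degree P"
    by (rule card_poly_roots_bound[OF \<open>P \<noteq> 0\<close>])
  also have "\<dots> \<le> d"
    unfolding P_def by (intro degree_sum_le) (auto simp: I zonal_degree)
  finally show ?thesis by (simp add: I)
qed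

lemma finite_distance_set: "finite X \<Longrightarrow> finite (distance_set \<tau> X)"
  unfolding distance_set_def by (rule finite_subset[of _ "(\<lambda>(x, y). \<tau> x y) ` (X \<times> X)"]) auto

lemma distance_setI: "x \<in> X \<Longrightarrow> y \<in> X \<Longrightarrow> x \<noteq> y \<Longrightarrow> \<tau> x y \<in> distance_set \<tau> X"
  unfolding distance_set_def by blast

lemma distance_set_subset: "distance_set \<tau> X \<subseteq> {\<tau> x y |x y. x \<noteq> y}"
  by (auto simp: distance_set_def)

lemma \<tau>0_notin_distance_set: "\<tau>0 \<notin> distance_set \<tau> X"
  by (simp add: distance_set_def) (metis \<tau>_eq_\<tau>0_iff)

text \<open>Makes zonal polynomials available in all degrees up to the number of distances, so that
  polynomials of such degree can be expanded.\<close>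

lemma distance_set_size_in_index: "card (distance_set \<tau> X) \<in> I"
  by (rule card_distances_in_index[OF distance_set_subset])

subsection \<open>The bounds for distance sets\<close>

text \<open>The distance distribution of \<open>X\<close> is a feasible point of the linear program,
  with value exactly \<open>card X\<close>.\<close>

lemma card_le_L_bound:
  assumes X: "finite X" "X \<noteq> {}"
  shows "ereal (real (card X)) \<le> L_bound I \<Phi> (distance_set \<tau> X)"
proof -
  define D where "D = distance_set \<tau> X"
  define Q where "Q = {p \<in> X \<times> X. fst p \<noteq> snd p}"
  \<comment> \<open>Delsarte's inner distribution: the average number of points of \<open>X\<close>
    at \<open>\<tau>\<close>-value \<open>a\<close> from a point of \<open>X\<close>.\<close>
  define \<alpha> where "\<alpha> a = real (card {p \<in> Q. \<tau> (fst p) (snd p) = a}) / real (card X)" for a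
  have n: "card X > 0" using X by (simp add: card_gt_0_iff)
  have "finite Q" unfolding Q_def using X by simp
  have "finite D" unfolding D_def by (rule finite_distance_set[OF X(1)])
  have \<alpha>_sum: "(\<Sum>a\<in>D. \<alpha> a * F a) = (\<Sum>p\<in>Q. F (\<tau> (fst p) (snd p))) / real (card X)" for F
  proof -
    have "(\<Sum>a\<in>D. \<alpha> a * F a) = (\<Sum>a\<in>D. \<Sum>p | p \<in> Q \<and> \<tau> (fst p) (snd p) = a. F (\<tau> (fst p) (snd p))) / real (card X)"
      unfolding sum_divide_distrib[of _ D] by (intro sum.cong) (auto simp: \<alpha>_def)
    also have "(\<Sum>a\<in>D. \<Sum>p | p \<in> Q \<and> \<tau> (fst p) (snd p) = a. F (\<tau> (fst p) (snd p))) = (\<Sum>p\<in>Q. F (\<tau> (fst p) (snd p)))"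
      using \<open>finite Q\<close> \<open>finite D\<close> by (intro sum.group) (auto simp: Q_def D_def intro: distance_setI)
    finally show ?thesis .
  qed
  have Q_sum: "(\<Sum>p\<in>Q. F (\<tau> (fst p) (snd p))) = (\<Sum>x\<in>X. \<Sum>y\<in>X. F (\<tau> x y)) - real (card X) * F \<tau>0" for F
  proof -
    have "(\<Sum>x\<in>X. \<Sum>y\<in>X. F (\<tau> x y)) = (\<Sum>p\<in>X \<times> X. F (\<tau> (fst p) (snd p)))"
      by (simp add: sum.cartesian_product case_prod_beta)
    also have "\<dots> = (\<Sum>p\<in>Q. F (\<tau> (fst p) (snd p))) + (\<Sum>p\<in>(\<lambda>x. (x, x)) ` X. F (\<tau> (fst p) (snd p)))"
      using X by (subst sum.union_disjoint[symmetric]) (auto simp: Q_def intro!: sum.cong)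
    also have "(\<Sum>p\<in>(\<lambda>x. (x, x)) ` X. F (\<tau> (fst p) (snd p))) = real (card X) * F \<tau>0"
      by (subst sum.reindex) (auto simp: inj_on_def \<tau>0)
    finally show ?thesis by simp
  qed
  \<comment> \<open>The sum over all ordered pairs is nonnegative; its diagonal part,
    \<open>card X\<close> times \<open>poly (\<Phi> k) \<tau>0 = 1\<close>, accounts for the
    -1.\<close>
  have "(\<Sum>a\<in>D. \<alpha> a * poly (\<Phi> k) a) \<ge> -1" if k: "k \<in> I" for k
  proof -
    have "complex_of_real (\<Sum>x\<in>X. \<Sum>y\<in>X. poly (\<Phi> k) (\<tau> x y)) =
        of_real ((\<Sum>i<h k. (cmod (\<Sum>x\<in>X. 1 * \<phi> k i x))\<^sup>2) / real (h k))"
      unfolding zonal_quadratic_form[OF k, where c = "\<lambda>_. 1", symmetric] by simp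
    then have "(\<Sum>x\<in>X. \<Sum>y\<in>X. poly (\<Phi> k) (\<tau> x y)) = (\<Sum>i<h k. (cmod (\<Sum>x\<in>X. 1 * \<phi> k i x))\<^sup>2) / real (h k)"
      by (simp only: of_real_eq_iff)
    also have "\<dots> \<ge> 0" by (intro divide_nonneg_nonneg sum_nonneg) auto
    finally have "(\<Sum>x\<in>X. \<Sum>y\<in>X. poly (\<Phi> k) (\<tau> x y)) \<ge> 0" .
    then show ?thesis
      using n by (simp add: \<alpha>_sum Q_sum zonal_\<tau>0[OF k] field_simps)
  qed
  then have "ereal (1 + (\<Sum>a\<in>D. \<alpha> a)) \<le> L_bound I \<Phi> D"
    unfolding L_bound_def by (intro SUP_upper) (auto simp: \<alpha>_def)
  moreover have "1 + (\<Sum>a\<in>D. \<alpha> a) = real (card X)"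
  proof -
    have "(1 + (\<Sum>a\<in>D. \<alpha> a)) * real (card X) = real (card X) * real (card X)"
      using \<alpha>_sum[of "\<lambda>_. 1"] Q_sum[of "\<lambda>_. 1"] n by (simp add: field_simps)
    then show ?thesis using n by simp
  qed
  ultimately show ?thesis by (simp add: D_def)
qed

section \<open>The bound from harmonics with positive coefficients\<close>

text \<open>Existence and uniqueness behind the definite description \<open>zonal_coeff\<close>. The
  premise \<open>card D \<in> I\<close> provides a zonal polynomial in each degree up to
  \<open>card D\<close>.\<close>

lemma annihilator_poly_zonal_coeff:
  assumes "card D \<in> I" "finite D"
  shows "annihilator_poly \<tau>0 D = (\<Sum>i\<le>card D. Polynomial.smult (zonal_coeff \<Phi> \<tau>0 D i) (\<Phi> i))"
proof -
  have deg: "degree (\<Phi> i) = i" if "i \<le> card D" for i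
    using zonal_degree index_down_closed[OF assms(1) that] by blast
  let ?Q = "\<lambda>c. annihilator_poly \<tau>0 D = (\<Sum>i\<le>card D. Polynomial.smult (c i) (\<Phi> i)) \<and> (\<forall>i>card D. c i = 0)"
  have "degree (annihilator_poly \<tau>0 D) \<le> (\<Sum>a\<in>D. 1)"
    unfolding annihilator_poly_def
    by (rule order.trans[OF degree_prod_sum_le[OF assms(2)]])
      (auto intro!: sum_mono order.trans[OF degree_smult_le] simp del: sum_constant)
  then have "degree (annihilator_poly \<tau>0 D) \<le> card D" by simp
  then obtain c where c: "annihilator_poly \<tau>0 D = (\<Sum>i\<le>card D. Polynomial.smult (c i) (\<Phi> i))"
    using graded_expansion_exists[of "card D" \<Phi>] deg zonal_0_nonzero by blast
  \<comment> \<open>Values beyond \<open>card D\<close> are set to 0, as the description demands in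
    order to determine a function.\<close>
  define c' where "c' i = (if i \<le> card D then c i else 0)" for i
  have "?Q c'" using c by (simp add: c'_def)
  moreover have "c'' = c'" if "?Q c''" for c''
  proof
    fix i
    have "(\<Sum>i\<le>card D. Polynomial.smult (c'' i - c' i) (\<Phi> i)) = 0"
      using that \<open>?Q c'\<close> by (simp add: smult_diff_left sum_subtractf)
    then have "c'' i - c' i = 0" if "i \<le> card D"
      using graded_expansion_unique[of "card D" \<Phi> "\<lambda>i. c'' i - c' i"] that deg zonal_0_nonzero by blast
    then show "c'' i = c' i"
      using that by (cases "i \<le> card D") (auto simp: c'_def)
  qed
  ultimately have "?Q (zonal_coeff \<Phi> \<tau>0 D)"
    unfolding zonal_coeff_def by (rule theI)
  then show ?thesis by blast
qed

text \<open>The annihilator kernel is the identity on \<open>X\<close>, so its form is positive at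
  nonzero vectors. If the points outnumber the harmonics with positive coefficient, some nonzero
  \<open>c\<close> is orthogonal to all of these, and the zonal expansion of the form has no
  positive term left.\<close>

lemma card_le_H_bound:
  assumes X: "finite X"
  shows "card X \<le> H_bound V \<Phi> \<tau>0 (distance_set \<tau> X)"
proof (rule ccontr)
  assume contr: "\<not> card X \<le> H_bound V \<Phi> \<tau>0 (distance_set \<tau> X)"
  define D where "D = distance_set \<tau> X"
  define f where "f = zonal_coeff \<Phi> \<tau>0 D"
  \<comment> \<open>Pairs of a degree with positive coefficient and a position in its basis; their
    number is the bound.\<close>
  define R where "R = (SIGMA i:{i. i \<le> card D \<and> f i > 0}. {..<h i})"
  have D: "finite D" "card D \<in> I"
    unfolding D_def by (rule finite_distance_set[OF X], rule distance_set_size_in_index)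
  have "finite R" by (auto simp: R_def)
  moreover have "card R < card X"
    using contr by (simp add: R_def H_bound_def D_def f_def)
  ultimately obtain c where c: "\<exists>x\<in>X. c x \<noteq> 0"
    and orth: "\<And>r. r \<in> R \<Longrightarrow> (\<Sum>x\<in>X. (case r of (i, j) \<Rightarrow> \<phi> i j x) * c x) = 0"
    using nontrivial_kernel_on[of R X "\<lambda>r x. case r of (i, j) \<Rightarrow> \<phi> i j x"] X by blast
  have ann: "poly (annihilator_poly \<tau>0 D) (\<tau> x y) = (if x = y then 1 else 0)" if "x \<in> X" "y \<in> X" for x y
  proof (cases "x = y")
    case True
    have "(a - \<tau>0) / (a - \<tau>0) = 1" if "a \<in> D" for a
      using that \<tau>0_notin_distance_set[of X] by (auto simp: D_def)
    then show ?thesis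
      using True by (simp add: annihilator_poly_def poly_prod \<tau>0 flip: diff_divide_distrib)
  next
    case False
    then have "\<tau> x y \<in> D" using that by (simp add: D_def distance_setI)
    then show ?thesis
      using False D(1) by (auto simp: annihilator_poly_def poly_prod)
  qed
  define S where "S i = (\<Sum>j<h i. (cmod (\<Sum>x\<in>X. c x * \<phi> i j x))\<^sup>2) / real (h i)" for i
  have "complex_of_real (\<Sum>x\<in>X. (cmod (c x))\<^sup>2) =
      (\<Sum>x\<in>X. \<Sum>y\<in>X. c x * cnj (c y) * of_real (poly (annihilator_poly \<tau>0 D) (\<tau> x y)))"
    using X by (simp add: ann if_distrib cong: if_cong flip: complex_norm_square)
  also have "\<dots> = (\<Sum>x\<in>X. \<Sum>y\<in>X. \<Sum>i\<le>card D. of_real (f i) * (c x * cnj (c y) * of_real (poly (\<Phi> i) (\<tau> x y))))"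
    by (simp add: annihilator_poly_zonal_coeff[OF D(2,1)] f_def poly_sum sum_distrib_left mult_ac)
  also have "\<dots> = (\<Sum>i\<le>card D. of_real (f i) * (\<Sum>x\<in>X. \<Sum>y\<in>X. c x * cnj (c y) * of_real (poly (\<Phi> i) (\<tau> x y))))"
    by (subst sum.swap, subst (2) sum.swap, subst sum.swap)
      (simp add: sum_distrib_left, rule sum.cong[OF refl], rule sum.swap)
  also have "\<dots> = (\<Sum>i\<le>card D. of_real (f i) * of_real (S i))"
    unfolding S_def using index_down_closed[OF D(2)] by (intro sum.cong) (auto simp only: zonal_quadratic_form atMost_iff)
  also have "\<dots> = complex_of_real (\<Sum>i\<le>card D. f i * S i)"
    by simp
  finally have "(\<Sum>x\<in>X. (cmod (c x))\<^sup>2) = (\<Sum>i\<le>card D. f i * S i)"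
    by (simp only: of_real_eq_iff)
  also have "\<dots> \<le> 0"
  proof (rule sum_nonpos)
    fix i assume i: "i \<in> {..card D}"
    show "f i * S i \<le> 0"
    proof (cases "f i > 0")
      case True
      then have "(\<Sum>x\<in>X. c x * \<phi> i j x) = 0" if "j < h i" for j
        using orth[of "(i, j)"] i that by (simp add: R_def mult.commute)
      then show ?thesis by (simp add: S_def)
    next
      case False
      moreover have "S i \<ge> 0" unfolding S_def by (intro divide_nonneg_nonneg sum_nonneg) auto
      ultimately show ?thesis by (intro mult_nonpos_nonneg) auto
    qed
  qed
  finally have "(\<Sum>x\<in>X. (cmod (c x))\<^sup>2) \<le> 0" .
  moreover obtain x where "x \<in> X" "c x \<noteq> 0" using c by blast
  then have "(\<Sum>x\<in>X. (cmod (c x))\<^sup>2) > 0"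
    using X by (intro sum_pos2[of X x]) auto
  ultimately show False by simp
qed

section \<open>Integrality of the ratios for large distance sets\<close>

text \<open>The interpolation kernel enters through its rank: degree i contributes at most
  \<open>h i\<close>, which adds up to \<open>harmonic_dim_sum\<close>, at most half of
  \<open>card X\<close>.\<close>

lemma LRS_ratio_integer:
  assumes X: "finite X" "X \<noteq> {}" and a: "a \<in> distance_set \<tau> X"
    and large: "2 * harmonic_dim_sum I V (card (distance_set \<tau> X)) \<le> card X"
  shows "LRS_ratio \<tau>0 (distance_set \<tau> X) a \<in> \<int>"
proof -
  define D where "D = distance_set \<tau> X"
  have D: "finite D" "card D \<in> I"
    unfolding D_def by (rule finite_distance_set[OF X(1)], rule distance_set_size_in_index)
  have "card D > 0"
    using a D(1) by (auto simp: card_gt_0_iff D_def)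
  \<comment> \<open>Here \<open>s\<close> is one less than the number of distances, the number of
    zeros prescribed for \<open>F\<close>. The sum \<open>harmonic_dim_sum\<close> at
    \<open>card D\<close> runs over the degrees up to this \<open>s\<close>.\<close>
  define s where "s = card D - 1"
  have card_D: "card D = Suc s" using \<open>card D > 0\<close> by (simp add: s_def)
  have sub: "i \<in> I" if "i \<le> s" for i
    using index_down_closed[OF D(2)] that by (simp add: card_D)
  \<comment> \<open>The Lagrange polynomial of the node \<open>a\<close> among the nodes
    \<open>D\<close>; its value at \<open>\<tau>0\<close> is
    \<open>LRS_ratio \<tau>0 D a\<close>.\<close>
  define F where "F = (\<Prod>b\<in>D - {a}. Polynomial.smult (1 / (b - a)) [:b, -1:])"
  have "degree F \<le> (\<Sum>b\<in>D - {a}. 1)"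
    unfolding F_def using D(1)
    by (intro order.trans[OF degree_prod_sum_le])
      (auto intro!: sum_mono order.trans[OF degree_smult_le] simp del: sum_constant)
  also have "\<dots> = s"
    using a D(1) by (simp add: s_def D_def)
  finally have "degree F \<le> s" .
  then obtain c where c: "F = (\<Sum>i\<le>s. Polynomial.smult (c i) (\<Phi> i))"
    using graded_expansion_exists[of s \<Phi> F] zonal_degree sub zonal_0_nonzero by blast
  have poly_F: "poly F t = (\<Prod>b\<in>D - {a}. (b - t) / (b - a))" for t
    by (simp add: F_def poly_prod flip: diff_divide_distrib)
  define R where "R = (SIGMA i:{..s}. {..<h i})"
  have "finite R" by (simp add: R_def)
  have "I \<inter> {..<Suc s} = {..s}" using sub by auto
  then have "card R = harmonic_dim_sum I V (card D)"
    by (simp add: R_def harmonic_dim_sum_def card_D)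
  \<comment> \<open>The matrix of \<open>F\<close> on \<open>X\<close> factors through the harmonics
    of degree at most \<open>s\<close>, with the expansion coefficients absorbed into
    \<open>u\<close>.\<close>
  have "complex_of_real (LRS_ratio \<tau>0 D a) \<in> \<int>"
  proof (rule adjacency_plus_scalar_low_rank_imp_integer_on[where X = X and R = R and E = "\<lambda>x y. \<tau> x y = a"
        and u = "\<lambda>x r. of_real (c (fst r) / real (h (fst r))) * \<phi> (fst r) (snd r) x"
        and v = "\<lambda>r y. cnj (\<phi> (fst r) (snd r) y)"])
    show "2 * card R \<le> card X"
      using large \<open>card R = _\<close> by (simp add: D_def)
    show "\<tau> x x \<noteq> a" for x
      using a \<tau>0_notin_distance_set[of X] by (auto simp: \<tau>0)
    fix x y assume xy: "x \<in> X" "y \<in> X"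
    have "complex_of_real (poly F (\<tau> x y)) = of_bool (\<tau> x y = a) + (if x = y then complex_of_real (LRS_ratio \<tau>0 D a) else 0)"
    proof (cases "x = y")
      case True
      then show ?thesis
        using a \<tau>0_notin_distance_set[of X] by (auto simp: \<tau>0 poly_F LRS_ratio_def)
    next
      case False
      then have "\<tau> x y \<in> D" using xy by (simp add: D_def distance_setI)
      then show ?thesis
        using False D(1) by (cases "\<tau> x y = a") (auto simp: poly_F intro!: prod.neutral)
    qed
    moreover have "complex_of_real (poly F (\<tau> x y)) =
        (\<Sum>i\<le>s. of_real (c i) * ((\<Sum>j<h i. \<phi> i j x * cnj (\<phi> i j y)) / of_nat (h i)))"
      unfolding c using sub by (simp add: poly_sum zonal)
    moreover have "\<dots> = (\<Sum>i\<le>s. \<Sum>j<h i. (of_real (c i / real (h i)) * \<phi> i j x) * cnj (\<phi> i j y))"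
      by (simp add: sum_distrib_left sum_divide_distrib mult_ac)
    moreover have "\<dots> = (\<Sum>r\<in>R. of_real (c (fst r) / real (h (fst r))) * \<phi> (fst r) (snd r) x *
        cnj (\<phi> (fst r) (snd r) y))"
      unfolding R_def by (subst sum.Sigma) (auto intro!: sum.cong)
    ultimately show "of_bool (\<tau> x y = a) + (if x = y then complex_of_real (LRS_ratio \<tau>0 D a) else 0) =
        (\<Sum>r\<in>R. of_real (c (fst r) / real (h (fst r))) * \<phi> (fst r) (snd r) x * cnj (\<phi> (fst r) (snd r) y))"
      by metis
  qed (use X \<open>finite R\<close> \<tau>_commute in auto)
  then show ?thesis
    by (simp only: of_real_in_Ints_iff D_def)
qed

lemma card_distance_set_le:
  assumes "finite X" and s: "card (distance_set \<tau> X) = s" "s \<ge> 1"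
  shows "ereal (real (card X)) \<le>
    max (SUP D\<in>integral_distance_sets \<tau> \<tau>0 s. B_bound I V \<Phi> \<tau>0 D)
        (ereal (2 * real (harmonic_dim_sum I V s) - 1))"
proof (cases "2 * harmonic_dim_sum I V s \<le> card X")
  case False
  then have "real (card X) \<le> 2 * real (harmonic_dim_sum I V s) - 1" by linarith
  then show ?thesis by (simp add: le_max_iff_disj)
next
  case True
  have "X \<noteq> {}" using s by (auto simp: distance_set_def)
  have "distance_set \<tau> X \<in> integral_distance_sets \<tau> \<tau>0 s"
    unfolding integral_distance_sets_def
    using distance_set_subset finite_distance_set[OF assms(1)] s
      LRS_ratio_integer[OF assms(1) \<open>X \<noteq> {}\<close>] True by auto
  moreover have "ereal (real (card X)) \<le> B_bound I V \<Phi> \<tau>0 (distance_set \<tau> X)"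
    unfolding B_bound_def
    using card_le_H_bound[OF assms(1)] card_le_L_bound[OF assms(1) \<open>X \<noteq> {}\<close>] by simp
  ultimately show ?thesis
    by (intro max.coboundedI1 SUP_upper2)
qed

end

theorem theorem2p10:
  fixes G :: "('g, 'r) monoid_scheme"
    and T :: "'g topology"
    and act :: "'g \<Rightarrow> 'm::metric_space \<Rightarrow> 'm"
    and \<A> :: "('m, 'e::euclidean_space) chart set"
    and g :: "('m, 'e) metric_tensor"
    and \<tau> :: "'m \<Rightarrow> 'm \<Rightarrow> real"
    and \<tau>0 :: real
    and \<mu> :: "'m measure"
    and I :: "nat set"
    and V :: "nat \<Rightarrow> ('m \<Rightarrow> complex) set"
    and \<phi> :: "nat \<Rightarrow> nat \<Rightarrow> 'm \<Rightarrow> complex"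
    and \<Phi> :: "nat \<Rightarrow> real poly"
    and s :: nat
  assumes "two_point_homogeneous_space G T act \<A> g \<tau> \<tau>0 \<mu> I V \<phi> \<Phi>"
    and "s \<ge> 1"
  shows "max_distance_set_card \<tau> s \<le>
    max (SUP D\<in>integral_distance_sets \<tau> \<tau>0 s. B_bound I V \<Phi> \<tau>0 D)
        (ereal (2 * real (harmonic_dim_sum I V s) - 1))"
  unfolding max_distance_set_card_def
  using two_point_homogeneous_space.card_distance_set_le[OF assms(1) _ _ assms(2)]
  by (intro SUP_least) (simp only: mem_Collect_eq)

end
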